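(* Let $\lambda>0$, $0<\alpha\le1$, and let $\{D_f(t)\}_{t\ge0}$ be a Lévy subordinator, independent of $\{\hat N_\alpha(t)\}_{t\ge0}$, with $\mathbb E(D_f^r(t))<\infty$ for all $r>0$. Let $\hat N_\alpha^f(t)=\hat N_\alpha(D_f(t))$, $t\ge0$. Then the probability generating function $\hat G_\alpha^f(u,t)=\mathbb E\big(u^{\hat N_\alpha^f(t)}\big)$, $|u|\le1$, is given by $$\hat G_\alpha^f(u,t)=\frac{\sqrt u+1}{2\sqrt u}\sum_{l=0}^\infty\frac{(-\lambda(1-\sqrt u))^l}{\Gamma(\alpha l+1)}\mathbb E\big(D_f^{\alpha l}(t)\big)+\frac{\sqrt u-1}{2\sqrt u}\sum_{l=0}^\infty\frac{(-\lambda(1+\sqrt u))^l}{\Gamma(\alpha l+1)}\mathbb E\big(D_f^{\alpha l}(t)\big)$$ (at $u=0$ the right-hand side is understood as its limit as $u\to0$).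
   Context: Three-parameter Mittag-Leffler function: $E_{\alpha,\beta}^{\gamma}(x)=\frac{1}{\Gamma(\gamma)}\sum_{j=0}^\infty\frac{\Gamma(j+\gamma)x^j}{j!\,\Gamma(j\alpha+\beta)}$ for $\alpha,\beta,\gamma>0$. For $\lambda>0$ and $0<\alpha\le1$, $\{\hat N_\alpha(t)\}_{t\ge0}$ is the renewal counting process with $\hat N_\alpha(0)=0$ whose i.i.d. interarrival times have density $\lambda^2t^{2\alpha-1}E^2_{\alpha,2\alpha}(-\lambda t^\alpha)$, $t>0$. Its probability mass function is, for $n\ge0$, $$\Pr\{\hat N_\alpha(t)=n\}=\lambda^{2n}t^{2n\alpha}E_{\alpha,2n\alpha+1}^{2n+1}(-\lambda t^\alpha)+\lambda^{2n+1}t^{(2n+1)\alpha}E_{\alpha,(2n+1)\alpha+1}^{2n+2}(-\lambda t^\alpha).$$ A Lévy subordinator $\{D_f(t)\}_{t\ge0}$ is a one-dimensional Lévy process with non-decreasing paths, $D_f(0)=0$ a.s., and $\mathbb E(e^{-sD_f(t)})=e^{-tf(s)}$, $s>0$, where $f(s)=cs+\int_0^\infty(1-e^{-sx})\bar\nu(\mathrm dx)$ is its Bernstein function ($c\ge0$, $\int_0^\infty(x\wedge1)\bar\nu(\mathrm dx)<\infty$). $D_f^{a}(t)$ denotes $(D_f(t))^a$. The choice of square root $\sqrt u$ is immaterial since the expression is unchanged under $\sqrt u\mapsto-\sqrt u$.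
   Formalization: The formula is asserted for those u at which both series on the right converge, and the limit at u = 0 when they converge for all u ≠ 0 near 0; finite moments alone do not ensure this (e.g. α = 1, gamma subordinator with rate below λ). *)

theory Defs
  imports "HOL-Probability.Probability"
begin

definition mittag_leffler3 :: "real \<Rightarrow> real \<Rightarrow> real \<Rightarrow> real \<Rightarrow> real" where
  "mittag_leffler3 \<alpha> \<beta> \<gamma> x =
     (1 / Gamma \<gamma>) *
     (\<Sum>j. Gamma (real j + \<gamma>) * x ^ j / (fact j * Gamma (real j * \<alpha> + \<beta>)))"

definition interarrival_density :: "real \<Rightarrow> real \<Rightarrow> real \<Rightarrow> real" where
  "interarrival_density lam \<alpha> x =
     (if 0 < x
      then lam\<^sup>2 * x powr (2 * \<alpha> - 1) * mittag_leffler3 \<alpha> (2 * \<alpha>) 2 (- lam * x powr \<alpha>)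
      else 0)"

text \<open>
  The interarrival times are \<open>X 0, X 1, \<dots>\<close>, so the \<open>n\<close>-th renewal epoch is \<open>\<Sum>i<n. X i\<close> and
  \<open>N t\<close> counts the renewal epochs up to time \<open>t\<close>. For a density vanishing on the nonpositive
  half-line, \<open>N 0 = 0\<close> holds almost surely, and almost surely the counted set is finite.
  The defining equation is imposed at negative times as well: there \<open>N\<close> is almost surely 0, and this
  keeps a time change of \<open>N\<close> measurable on the null set where the random time may be negative.
\<close>

definition renewal_counting_process ::
    "'a measure \<Rightarrow> (real \<Rightarrow> real) \<Rightarrow> (real \<Rightarrow> 'a \<Rightarrow> nat) \<Rightarrow> bool" where
  "renewal_counting_process M \<phi> N \<longleftrightarrow>
     (\<exists>X :: nat \<Rightarrow> 'a \<Rightarrow> real.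
        prob_space.indep_vars M (\<lambda>_. borel) X UNIV \<and>
        (\<forall>n. distributed M lborel (X n) (\<lambda>x. ennreal (\<phi> x))) \<and>
        (\<forall>t. \<forall>\<omega>\<in>space M. N t \<omega> = card {n. 1 \<le> n \<and> (\<Sum>i<n. X i \<omega>) \<le> t}))"

definition bernstein_function :: "(real \<Rightarrow> real) \<Rightarrow> bool" where
  "bernstein_function f \<longleftrightarrow>
     (\<exists>(c :: real) (\<nu> :: real measure).
        0 \<le> c \<and> sets \<nu> = sets borel \<and>
        set_integrable \<nu> {0<..} (\<lambda>x. min x 1) \<and>
        (\<forall>s>0. f s = c * s + (LINT x:{0<..}|\<nu>. 1 - exp (- s * x))))"

text \<open>Processes are indexed by \<open>real\<close>; only times \<open>t \<ge> 0\<close> are constrained.\<close>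

definition levy_process :: "'a measure \<Rightarrow> (real \<Rightarrow> 'a \<Rightarrow> real) \<Rightarrow> bool" where
  "levy_process M D \<longleftrightarrow>
     (\<forall>t\<ge>0. D t \<in> borel_measurable M) \<and>
     (AE \<omega> in M. D 0 \<omega> = 0) \<and>
     (\<forall>(n :: nat) (\<tau> :: nat \<Rightarrow> real). 0 \<le> \<tau> 0 \<and> mono \<tau> \<longrightarrow>
        prob_space.indep_vars M (\<lambda>_. borel) (\<lambda>i \<omega>. D (\<tau> (Suc i)) \<omega> - D (\<tau> i) \<omega>) {..<n}) \<and>
     (\<forall>s\<ge>0. \<forall>t\<ge>0. distr M borel (\<lambda>\<omega>. D (s + t) \<omega> - D s \<omega>) = distr M borel (D t)) \<and>
     (\<forall>t\<ge>0. \<forall>\<epsilon>>0.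
        ((\<lambda>s. measure M {\<omega> \<in> space M. \<epsilon> < \<bar>D s \<omega> - D t \<omega>\<bar>}) \<longlongrightarrow> 0) (at t within {0..})) \<and>
     (AE \<omega> in M. \<forall>t\<ge>0. continuous (at_right t) (\<lambda>s. D s \<omega>)) \<and>
     (AE \<omega> in M. \<forall>t>0. \<exists>l. ((\<lambda>s. D s \<omega>) \<longlongrightarrow> l) (at_left t))"

definition levy_subordinator ::
    "'a measure \<Rightarrow> (real \<Rightarrow> real) \<Rightarrow> (real \<Rightarrow> 'a \<Rightarrow> real) \<Rightarrow> bool" where
  "levy_subordinator M f D \<longleftrightarrow>
     levy_process M D \<and>
     (AE \<omega> in M. mono_on {0..} (\<lambda>t. D t \<omega>)) \<and>
     bernstein_function f \<and>
     (\<forall>t\<ge>0. \<forall>s>0. (LINT \<omega>|M. exp (- s * D t \<omega>)) = exp (- t * f s))"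

text \<open>
  Independence of the processes, i.e. of their trajectories on \<open>{0..}\<close> as random elements of the
  product space. The cast to \<open>real\<close> is there because \<open>indep_var\<close> wants both of the same type.
\<close>

definition independent_processes ::
    "'a measure \<Rightarrow> (real \<Rightarrow> 'a \<Rightarrow> nat) \<Rightarrow> (real \<Rightarrow> 'a \<Rightarrow> real) \<Rightarrow> bool" where
  "independent_processes M N D \<longleftrightarrow>
     prob_space.indep_var M
       (Pi\<^sub>M {0..} (\<lambda>_. borel)) (\<lambda>\<omega>. \<lambda>t\<in>{0..}. real (N t \<omega>))
       (Pi\<^sub>M {0..} (\<lambda>_. borel)) (\<lambda>\<omega>. \<lambda>t\<in>{0..}. D t \<omega>)"

definition time_changed :: "(real \<Rightarrow> 'a \<Rightarrow> nat) \<Rightarrow> (real \<Rightarrow> 'a \<Rightarrow> real) \<Rightarrow> real \<Rightarrow> 'a \<Rightarrow> nat" where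
  "time_changed N D t \<omega> = N (D t \<omega>) \<omega>"

definition prob_gen_fun :: "'a measure \<Rightarrow> ('a \<Rightarrow> nat) \<Rightarrow> complex \<Rightarrow> complex" where
  "prob_gen_fun M Y u = (LINT \<omega>|M. u ^ Y \<omega>)"

text \<open>
  The moment of order 0 is 1 also when \<open>Y\<close> vanishes with positive probability, whereas
  \<open>0 powr 0 = 0\<close>; hence the case distinction.
\<close>

definition moment :: "'a measure \<Rightarrow> ('a \<Rightarrow> real) \<Rightarrow> real \<Rightarrow> real" where
  "moment M Y r = (LINT \<omega>|M. (if r = 0 then 1 else Y \<omega> powr r))"

definition moment_series_term ::
    "'a measure \<Rightarrow> real \<Rightarrow> ('a \<Rightarrow> real) \<Rightarrow> complex \<Rightarrow> nat \<Rightarrow> complex" where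
  "moment_series_term M \<alpha> Y z l =
     z ^ l / complex_of_real (Gamma (\<alpha> * real l + 1)) * complex_of_real (moment M Y (\<alpha> * real l))"

text \<open>In the following two definitions \<open>s\<close> plays the role of a square root of \<open>u\<close>.
  Finiteness of all moments of \<open>Y\<close> does not imply that the two series converge (the radius of
  convergence may even be 0), and \<open>suminf\<close> is meaningless for a divergent series.\<close>

definition both_series_converge ::
    "'a measure \<Rightarrow> real \<Rightarrow> real \<Rightarrow> ('a \<Rightarrow> real) \<Rightarrow> complex \<Rightarrow> bool" where
  "both_series_converge M lam \<alpha> Y s \<longleftrightarrow>
     summable (moment_series_term M \<alpha> Y (- (complex_of_real lam * (1 - s)))) \<and>
     summable (moment_series_term M \<alpha> Y (- (complex_of_real lam * (1 + s))))"

definition pgf_formula ::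
    "'a measure \<Rightarrow> real \<Rightarrow> real \<Rightarrow> ('a \<Rightarrow> real) \<Rightarrow> complex \<Rightarrow> complex" where
  "pgf_formula M lam \<alpha> Y s =
     (s + 1) / (2 * s) * (\<Sum>l. moment_series_term M \<alpha> Y (- (complex_of_real lam * (1 - s))) l) +
     (s - 1) / (2 * s) * (\<Sum>l. moment_series_term M \<alpha> Y (- (complex_of_real lam * (1 + s))) l)"

end

theory Submission
  imports Defs
begin

text \<open>
  The proof computes \<open>G(x) = E(u ^ N(x))\<close> at a fixed time \<open>x \<ge> 0\<close>, substitutes the independent random
  time, and expands the result into moments. With \<open>s\<^sup>2 = u\<close>, the first step gives
  \<open>G(x) = (s + 1)/(2 s) E\<^sub>\<alpha>(-\<lambda>(1 - s) x\<^sup>\<alpha>) + (s - 1)/(2 s) E\<^sub>\<alpha>(-\<lambda>(1 + s) x\<^sup>\<alpha>)\<close>,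
  where \<open>E\<^sub>\<alpha>(z) = \<Sum> z\<^sup>m / \<Gamma>(\<alpha> m + 1)\<close>; the right-hand side is called \<open>renewal_pgf\<close> below.

  \<^bold>\<open>Fixed time.\<close> Let \<open>p\<^sub>a(x) = x\<^sup>a\<^sup>-\<^sup>1 / \<Gamma>(a)\<close> for \<open>x > 0\<close>. The Beta integral says that
  \<open>p\<^sub>a * p\<^sub>b = p\<^sub>a\<^sub>+\<^sub>b\<close>, so series in the kernels \<open>p\<^sub>\<alpha>\<^sub>m\<^sub>+\<^sub>\<beta>\<close> convolve like formal power series in
  \<open>w = \<lambda> p\<^sub>\<alpha>\<close> (\<open>kernel_series_convolution\<close>). In this calculus the interarrival density is
  \<open>q = (w / (1 + w))\<^sup>2\<close>, and \<open>G\<close> should be the convolution of the constant 1 with the expansion of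
  \<open>(1 - q) / (1 - u q) = (1 + 2 w) / ((1 + w)\<^sup>2 - s\<^sup>2 w\<^sup>2)\<close>, whose partial fractions are the two
  Mittag-Leffler terms. To avoid a double series, the candidate is shown to solve the renewal equation
  \<open>G = (1 - 1 * q) + u (G * q)\<close> (\<open>renewal_pgf_equation\<close>). Iterating this equation along the renewal
  epochs \<open>S\<^sub>n\<close> expresses the candidate as a partial sum of the generating function plus a remainder
  of order \<open>P(S\<^sub>n \<le> x)\<close>, which vanishes in the limit (\<open>pgf_count\<close>).

  \<^bold>\<open>Positivity.\<close> The law of an interarrival time has density \<open>ennreal (\<phi> x)\<close>, which replaces negative
  values of \<open>\<phi>\<close> by 0, so the calculation above is about the right law only because \<open>\<phi> \<ge> 0\<close>. Here
  \<open>\<phi> = \<psi> * \<psi>\<close>, where \<open>\<psi>\<close> expands \<open>w / (1 + w)\<close>, and \<open>\<psi> > 0\<close> because \<open>p\<^sub>\<alpha>\<close> is log-convex and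
  nonincreasing for \<open>\<alpha> \<le> 1\<close> (\<open>ml_density_pos\<close>).

  \<^bold>\<open>Random time.\<close> Independence allows substitution of a random time with countably many values. A general
  random time is approximated from above by such times, and right-continuity of \<open>N\<close> together with
  continuity of \<open>G\<close> gives \<open>E(u ^ N(D)) = E(G(D))\<close> (\<open>pgf_time_change\<close>).

  \<^bold>\<open>Moments.\<close> Expectation and Mittag-Leffler series may be interchanged inside the disc of convergence of
  the moment series. The series are only known to converge at the two points of interest, which may lie
  on the boundary of that disc, where absolute convergence can fail. Multiplying both arguments by
  \<open>r < 1\<close> moves them inside and turns \<open>G(x)\<close> into \<open>G(r\<^sup>1\<^sup>/\<^sup>\<alpha> x)\<close>, which is still a generating function and
  hence bounded by 1. As \<open>r \<rightarrow> 1\<close>, Abel's theorem handles the series and dominated convergence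
  handles the expectation (\<open>expectation_renewal_pgf_eq_pgf_formula\<close>).

  The limit at \<open>u = 0\<close> follows, since a probability generating function is continuous there.
\<close>


section \<open>Riemann-Liouville kernels\<close>

text \<open>
  The Riemann-Liouville kernel: convolution with it is the fractional integral of order \<open>a\<close>. It is
  extended by 0, so that convolutions over the whole line are the causal ones over \<open>{0..x}\<close>.
\<close>

definition frac_kernel :: "real \<Rightarrow> real \<Rightarrow> real" where
  "frac_kernel a x = (if 0 < x then x powr (a - 1) / Gamma a else 0)"

lemma frac_kernel_measurable [measurable]: "frac_kernel a \<in> borel_measurable borel"
  unfolding frac_kernel_def by measurable

lemma frac_kernel_nonneg: "0 < a \<Longrightarrow> 0 \<le> frac_kernel a x"
  by (simp add: frac_kernel_def Gamma_real_pos less_imp_le)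

text \<open>
  The semigroup law of fractional integration. Substituting \<open>y = x t\<close> turns the convolution into the
  Beta integral.
\<close>

lemma frac_kernel_convolution:
  assumes a: "0 < a" and b: "0 < b"
  shows "has_bochner_integral lborel (\<lambda>y. frac_kernel a (x - y) * frac_kernel b y) (frac_kernel (a + b) x)"
proof (cases "0 < x")
  case False
  then have "(\<lambda>y. frac_kernel a (x - y) * frac_kernel b y) = (\<lambda>_. 0)"
    by (auto simp: frac_kernel_def fun_eq_iff)
  with False show ?thesis by (simp add: frac_kernel_def has_bochner_integral_zero)
next
  case x: True
  let ?h = "\<lambda>t::real. indicator {0..1} t * (t powr (b - 1) * (1 - t) powr (a - 1))"
  have G: "0 < Gamma a" "0 < Gamma b" "0 < Gamma (a + b)"
    using a b by (simp_all add: Gamma_real_pos)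
  have "integral\<^sup>N lborel (\<lambda>t. ennreal (?h t)) = ennreal (Beta b a)"
    using nn_integral_has_integral_lebesgue[OF _ has_integral_Beta_real[OF b a]] by simp
  then have B: "has_bochner_integral lborel ?h (Beta b a)"
    using G by (intro has_bochner_integral_nn_integral) (auto simp: Beta_def add.commute)
  have "frac_kernel a (x - (0 + x * t)) * frac_kernel b (0 + x * t)
      = x powr (a + b - 2) / (Gamma a * Gamma b) * ?h t" for t
  proof (cases "0 < t \<and> t < 1")
    case True
    have "x - x * t = x * (1 - t)" by (simp add: algebra_simps)
    then have "(x - x * t) powr (a - 1) = x powr (a - 1) * (1 - t) powr (a - 1)"
      using True x by (simp add: powr_mult)
    moreover have "x powr (a + b - 2) = x powr (a - 1) * x powr (b - 1)"
      using x by (simp flip: powr_add)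
    moreover have "0 < x - x * t" "0 < x * t" using True x by simp_all
    ultimately show ?thesis using True x
      by (simp add: frac_kernel_def powr_mult)
  next
    case False
    then consider "t < 0" | "t = 0" | "t = 1" | "t > 1" by linarith
    then show ?thesis
      by cases (use x in \<open>auto simp: frac_kernel_def zero_less_mult_iff indicator_def\<close>)
  qed
  then have "has_bochner_integral lborel
      (\<lambda>t. frac_kernel a (x - (0 + x * t)) * frac_kernel b (0 + x * t))
      (x powr (a + b - 2) / (Gamma a * Gamma b) * Beta b a)"
    using has_bochner_integral_mult_right[OF B] by (simp only:)
  moreover have "x powr (a + b - 2) / (Gamma a * Gamma b) * Beta b a = frac_kernel (a + b) x /\<^sub>R \<bar>x\<bar>"
  proof -
    have "x powr (a + b - 1) = x powr (a + b - 2) * x"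
      using x powr_add[of x "a + b - 2" 1] by (simp add: algebra_simps)
    then show ?thesis using x G by (simp add: frac_kernel_def Beta_def field_simps)
  qed
  ultimately show ?thesis
    using lborel_has_bochner_integral_real_affine_iff[of x
        "\<lambda>y. frac_kernel a (x - y) * frac_kernel b y" "frac_kernel (a + b) x" 0] x
    by simp
qed

text \<open>
  Keeping only \<open>t \<ge> R\<close> in Euler's integral gives a lower bound that is geometric in \<open>x\<close> with an arbitrary
  ratio \<open>R\<close>. This is all the growth of \<open>\<Gamma>\<close> that the convergence proofs need.
\<close>

lemma Gamma_ge_powr:
  assumes x: "1 \<le> x" and R: "0 < (R::real)"
  shows "R powr (x - 1) * exp (- R) \<le> Gamma x"
proof -
  have E: "set_nn_integral lborel {R..} (\<lambda>t. ennreal (exp (- t))) = ennreal (exp (- R))"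
  proof -
    have "((\<lambda>t. exp (- 1 * t)) has_integral exp (- 1 * R) / 1) {R..}"
      by (rule has_integral_exp_minus_to_infinity) simp
    from nn_integral_has_integral_lebesgue'[OF _ this] show ?thesis by simp
  qed
  have "ennreal (R powr (x - 1) * exp (- R))
      = (\<integral>\<^sup>+ t. ennreal (R powr (x - 1)) * (ennreal (exp (- t)) * indicator {R..} t) \<partial>lborel)"
    by (simp add: nn_integral_cmult E ennreal_mult)
  also have "\<dots> \<le> (\<integral>\<^sup>+ t. ennreal (indicator {0..} t * t powr (x - 1) / exp t) \<partial>lborel)"
  proof (intro nn_integral_mono)
    fix t :: real
    show "ennreal (R powr (x - 1)) * (ennreal (exp (- t)) * indicator {R..} t)
      \<le> ennreal (indicator {0..} t * t powr (x - 1) / exp t)"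
    proof (cases "R \<le> t")
      case True
      then have "R powr (x - 1) * exp (- t) \<le> t powr (x - 1) * exp (- t)"
        using x R by (intro mult_right_mono powr_mono2) auto
      then show ?thesis using True R
        by (simp add: exp_minus divide_inverse flip: ennreal_mult)
    qed simp
  qed
  also have "\<dots> = ennreal (Gamma x)"
    using x by (simp add: Gamma_conv_nn_integral_real)
  finally show ?thesis using x by (simp add: Gamma_real_pos less_imp_le)
qed

lemma summable_power_div_Gamma:
  assumes \<alpha>: "0 < (\<alpha>::real)" and \<beta>: "0 < \<beta>" and C: "0 \<le> C"
  shows "summable (\<lambda>m. C ^ m / Gamma (\<alpha> * real m + \<beta>))"
proof -
  \<comment> \<open>The ratio is chosen so that the terms decay at least like \<open>(C / (2 C + 1))\<^sup>m\<close>.\<close>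
  define R where "R = (2 * C + 1) powr (1 / \<alpha>)"
  have R: "0 < R" using C by (simp add: R_def)
  have Ra: "R powr (\<alpha> * real m) = (2 * C + 1) ^ m" for m
    using \<alpha> C by (simp add: R_def powr_powr powr_realpow)
  define K where "K = exp R * R powr (1 - \<beta>)"
  show ?thesis
  proof (rule summable_comparison_test_ev)
    show "summable (\<lambda>m. K * (C / (2 * C + 1)) ^ m)"
      using C by (intro summable_mult summable_geometric) (simp add: field_simps)
    have "\<forall>\<^sub>F m in sequentially. 1 \<le> \<alpha> * real m + \<beta>"
      using \<alpha> by real_asymp
    then show "\<forall>\<^sub>F m in sequentially. norm (C ^ m / Gamma (\<alpha> * real m + \<beta>)) \<le> K * (C / (2 * C + 1)) ^ m"
    proof eventually_elim
      case (elim m)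
      have "(2 * C + 1) ^ m * R powr (\<beta> - 1) * exp (- R) \<le> Gamma (\<alpha> * real m + \<beta>)"
        using Gamma_ge_powr[OF elim R] by (simp add: powr_add powr_diff Ra add_diff_eq[symmetric])
      moreover have "0 < (2 * C + 1) ^ m * R powr (\<beta> - 1) * exp (- R)"
        using C R by simp
      ultimately have "C ^ m / Gamma (\<alpha> * real m + \<beta>) \<le> C ^ m / ((2 * C + 1) ^ m * R powr (\<beta> - 1) * exp (- R))"
        and "0 < Gamma (\<alpha> * real m + \<beta>)"
        using C by (auto intro!: divide_left_mono mult_pos_pos)
      moreover have "C ^ m / ((2 * C + 1) ^ m * R powr (\<beta> - 1) * exp (- R)) = K * (C / (2 * C + 1)) ^ m"
        using R by (simp add: K_def power_divide exp_minus powr_diff field_simps)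
      ultimately show ?case using C by simp
    qed
  qed
qed



section \<open>The convolution algebra of kernel series\<close>

text \<open>
  The coefficient sequences with a positive radius of convergence. Division by \<open>\<Gamma>(\<alpha> m + \<beta>)\<close> makes their
  kernel series converge everywhere, and the class is closed under Cauchy products.
\<close>

definition geometric_growth :: "(nat \<Rightarrow> 'a::real_normed_field) \<Rightarrow> bool" where
  "geometric_growth c \<longleftrightarrow> (\<exists>K C. 0 \<le> K \<and> 0 \<le> C \<and> (\<forall>m. norm (c m) \<le> K * C ^ m))"

definition cauchy_product :: "(nat \<Rightarrow> 'a) \<Rightarrow> (nat \<Rightarrow> 'a) \<Rightarrow> nat \<Rightarrow> 'a::comm_semiring_0" where
  "cauchy_product c d m = (\<Sum>i\<le>m. c i * d (m - i))"

definition kernel_series ::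
    "real \<Rightarrow> real \<Rightarrow> (nat \<Rightarrow> 'a::{real_normed_field,banach}) \<Rightarrow> real \<Rightarrow> 'a" where
  "kernel_series \<alpha> \<beta> c x = (\<Sum>m. c m * of_real (frac_kernel (\<alpha> * real m + \<beta>) x))"

lemma geometric_growthI: "0 \<le> K \<Longrightarrow> 0 \<le> C \<Longrightarrow> (\<And>m. norm (c m) \<le> K * C ^ m) \<Longrightarrow> geometric_growth c"
  unfolding geometric_growth_def by blast

lemma geometric_growth_power: "geometric_growth (\<lambda>m. z ^ m)"
  by (rule geometric_growthI[of 1 "norm z"]) (simp_all add: norm_power)

lemma geometric_growth_cmult: "geometric_growth c \<Longrightarrow> geometric_growth (\<lambda>m. a * c m)"
proof -
  assume "geometric_growth c"
  then obtain K C where c: "0 \<le> K" "0 \<le> C" "\<And>m. norm (c m) \<le> K * C ^ m"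
    unfolding geometric_growth_def by blast
  then show ?thesis
    by (intro geometric_growthI[of "norm a * K" C]) (auto simp: norm_mult mult.assoc intro: mult_left_mono)
qed

lemma geometric_growth_norm: "geometric_growth c \<Longrightarrow> geometric_growth (\<lambda>m. norm (c m))"
  by (simp add: geometric_growth_def)

lemma geometric_growth_add:
  assumes "geometric_growth c" "geometric_growth d"
  shows "geometric_growth (\<lambda>m. c m + d m)"
proof -
  obtain K C L D where c: "0 \<le> K" "0 \<le> C" "\<And>m. norm (c m) \<le> K * C ^ m"
    and d: "0 \<le> L" "0 \<le> D" "\<And>m. norm (d m) \<le> L * D ^ m"
    using assms unfolding geometric_growth_def by metis
  show ?thesis
  proof (rule geometric_growthI[of "K + L" "max C D"])
    fix m
    have "norm (c m + d m) \<le> K * C ^ m + L * D ^ m"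
      using c(3)[of m] d(3)[of m] norm_triangle_ineq[of "c m" "d m"] by linarith
    also have "\<dots> \<le> K * max C D ^ m + L * max C D ^ m"
      using c d by (intro add_mono mult_left_mono power_mono) auto
    finally show "norm (c m + d m) \<le> (K + L) * max C D ^ m" by (simp add: algebra_simps)
  qed (use c d in auto)
qed

lemma geometric_growth_cauchy_product:
  assumes "geometric_growth c" "geometric_growth d"
  shows "geometric_growth (cauchy_product c d)"
proof -
  obtain K C L D where c: "0 \<le> K" "0 \<le> C" "\<And>m. norm (c m) \<le> K * C ^ m"
    and d: "0 \<le> L" "0 \<le> D" "\<And>m. norm (d m) \<le> L * D ^ m"
    using assms unfolding geometric_growth_def by metis
  define B where "B = max C D"
  have B: "0 \<le> B" "C \<le> B" "D \<le> B" using c d by (auto simp: B_def)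
  show ?thesis
  proof (rule geometric_growthI[of "K * L" "2 * B"])
    fix m
    have "norm (cauchy_product c d m) \<le> (\<Sum>i\<le>m. norm (c i) * norm (d (m - i)))"
      unfolding cauchy_product_def by (rule order.trans[OF norm_sum]) (simp add: norm_mult)
    also have "\<dots> \<le> (\<Sum>i\<le>m. (K * B ^ i) * (L * B ^ (m - i)))"
    proof (intro sum_mono mult_mono)
      fix i
      show "norm (c i) \<le> K * B ^ i" "norm (d (m - i)) \<le> L * B ^ (m - i)"
        using c d B by (meson order.trans mult_left_mono power_mono)+
    qed (use c B in auto)
    also have "\<dots> = (\<Sum>i\<le>m. K * L * B ^ m)"
      by (intro sum.cong refl) (simp add: algebra_simps flip: power_add)
    also have "\<dots> = real (m + 1) * (K * L * B ^ m)" by simp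
    also have "\<dots> \<le> 2 ^ m * (K * L * B ^ m)"
    proof (intro mult_right_mono)
      have "m + 1 \<le> 2 ^ m" by (induction m) auto
      then show "real (m + 1) \<le> 2 ^ m" by (metis of_nat_le_iff of_nat_numeral of_nat_power)
    qed (use c d B in auto)
    finally show "norm (cauchy_product c d m) \<le> K * L * (2 * B) ^ m"
      by (simp add: power_mult_distrib algebra_simps)
  qed (use c d B in auto)
qed

lemma frac_kernel_shift:
  assumes "0 < x"
  shows "frac_kernel (\<alpha> * real m + \<beta>) x = x powr (\<beta> - 1) * ((x powr \<alpha>) ^ m / Gamma (\<alpha> * real m + \<beta>))"
proof -
  have "x powr (\<alpha> * real m + \<beta> - 1) = x powr (\<beta> - 1) * x powr (\<alpha> * real m)"
    by (simp flip: powr_add add: algebra_simps)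
  also have "x powr (\<alpha> * real m) = (x powr \<alpha>) ^ m"
    using assms by (simp add: powr_powr[symmetric] powr_realpow)
  finally show ?thesis using assms by (simp add: frac_kernel_def)
qed

lemma summable_geometric_growth_div_Gamma:
  fixes c :: "nat \<Rightarrow> 'a::real_normed_field"
  assumes \<alpha>: "0 < \<alpha>" and \<beta>: "0 < \<beta>" and "geometric_growth c" and y: "0 \<le> y"
  shows "summable (\<lambda>m. norm (c m) * (y ^ m / Gamma (\<alpha> * real m + \<beta>)))"
proof -
  obtain K C where c: "0 \<le> K" "0 \<le> C" "\<And>m. norm (c m) \<le> K * C ^ m"
    using assms unfolding geometric_growth_def by metis
  show ?thesis
  proof (rule summable_comparison_test)
    show "summable (\<lambda>m. K * ((C * y) ^ m / Gamma (\<alpha> * real m + \<beta>)))"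
      using c y by (intro summable_mult summable_power_div_Gamma \<alpha> \<beta>) simp
    have "norm (norm (c m) * (y ^ m / Gamma (\<alpha> * real m + \<beta>)))
        \<le> K * ((C * y) ^ m / Gamma (\<alpha> * real m + \<beta>))" for m
    proof -
      have G: "0 < Gamma (\<alpha> * real m + \<beta>)" using \<alpha> \<beta> by (simp add: Gamma_real_pos add_nonneg_pos)
      have "norm (c m) * (y ^ m / Gamma (\<alpha> * real m + \<beta>)) \<le> (K * C ^ m) * (y ^ m / Gamma (\<alpha> * real m + \<beta>))"
        using c(3)[of m] y G by (intro mult_right_mono) auto
      then show ?thesis using y G by (simp add: power_mult_distrib abs_mult)
    qed
    then show "\<exists>N. \<forall>n\<ge>N. norm (norm (c n) * (y ^ n / Gamma (\<alpha> * real n + \<beta>)))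
        \<le> K * ((C * y) ^ n / Gamma (\<alpha> * real n + \<beta>))" by blast
  qed
qed

lemma summable_kernel_series:
  fixes c :: "nat \<Rightarrow> 'a::{real_normed_field,banach}"
  assumes \<alpha>: "0 < \<alpha>" and \<beta>: "0 < \<beta>" and c: "geometric_growth c"
  shows "summable (\<lambda>m. norm (c m * of_real (frac_kernel (\<alpha> * real m + \<beta>) x)))"
proof (cases "0 < x")
  case False
  then show ?thesis by (simp add: frac_kernel_def)
next
  case True
  have "norm (c m * of_real (frac_kernel (\<alpha> * real m + \<beta>) x))
      = x powr (\<beta> - 1) * (norm (c m) * ((x powr \<alpha>) ^ m / Gamma (\<alpha> * real m + \<beta>)))" for m
  proof -
    have "norm (c m * of_real (frac_kernel (\<alpha> * real m + \<beta>) x))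
        = norm (c m) * frac_kernel (\<alpha> * real m + \<beta>) x"
      using \<alpha> \<beta> frac_kernel_nonneg[of "\<alpha> * real m + \<beta>" x] by (simp add: norm_mult add_nonneg_pos)
    then show ?thesis by (simp add: frac_kernel_shift[OF True])
  qed
  then show ?thesis
    using summable_mult[OF summable_geometric_growth_div_Gamma[OF \<alpha> \<beta> c, of "x powr \<alpha>"]] by simp
qed

lemma kernel_series_measurable [measurable]:
  "kernel_series \<alpha> \<beta> (c :: nat \<Rightarrow> 'a::{real_normed_field,banach,second_countable_topology}) \<in> borel_measurable borel"
  unfolding kernel_series_def[abs_def] by (intro borel_measurable_suminf) measurable

text \<open>
  Convolution of kernel series is the Cauchy product of their coefficients. Pointwise this is the Cauchy
  product of two absolutely convergent series combined with \<open>frac_kernel_convolution\<close>. The interchange of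
  sum and integral is dominated by the same series with the absolute values of the coefficients.
\<close>

lemma kernel_series_convolution:
  fixes c d :: "nat \<Rightarrow> 'a::{real_normed_field,banach,second_countable_topology}"
  assumes \<alpha>: "0 < \<alpha>" and \<beta>: "0 < \<beta>" and \<gamma>: "0 < \<gamma>"
    and c: "geometric_growth c" and d: "geometric_growth d"
  shows "has_bochner_integral lborel (\<lambda>y. kernel_series \<alpha> \<beta> c (x - y) * kernel_series \<alpha> \<gamma> d y)
           (kernel_series \<alpha> (\<beta> + \<gamma>) (cauchy_product c d) x)"
proof -
  define P where "P i j y = frac_kernel (\<alpha> * real i + \<beta>) (x - y) * frac_kernel (\<alpha> * real j + \<gamma>) y" for i j y
  \<comment> \<open>The terms of the Cauchy product, and their majorants.\<close>
  define F where "F k y = (\<Sum>i\<le>k. c i * d (k - i) * of_real (P i (k - i) y))" for k y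
  define G where "G k y = (\<Sum>i\<le>k. norm (c i) * norm (d (k - i)) * P i (k - i) y)" for k y
  let ?p = "\<lambda>k. frac_kernel (\<alpha> * real k + (\<beta> + \<gamma>)) x"
  have pos: "0 < \<alpha> * real i + \<beta>" "0 < \<alpha> * real i + \<gamma>" for i
    using \<alpha> \<beta> \<gamma> by (simp_all add: add_nonneg_pos)
  have P: "has_bochner_integral lborel (P i (k - i)) (?p k)" if "i \<le> k" for i k
  proof -
    have "\<alpha> * real i + \<beta> + (\<alpha> * real (k - i) + \<gamma>) = \<alpha> * real k + (\<beta> + \<gamma>)"
      using that by (simp add: of_nat_diff algebra_simps)
    from this[symmetric] show ?thesis
      using frac_kernel_convolution[OF pos(1)[of i] pos(2)[of "k - i"], of x]
      unfolding P_def[abs_def] by (simp only:)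
  qed
  have P0: "0 \<le> P i j y" for i j y
    using pos by (simp add: P_def frac_kernel_nonneg)
  have Fi: "has_bochner_integral lborel (F k) (cauchy_product c d k * of_real (?p k))" for k
  proof -
    have "has_bochner_integral lborel (\<lambda>y. \<Sum>i\<le>k. c i * d (k - i) * of_real (P i (k - i) y))
        (\<Sum>i\<le>k. c i * d (k - i) * of_real (?p k))"
      by (intro has_bochner_integral_sum has_bochner_integral_mult_right has_bochner_integral_of_real P) auto
    then show ?thesis by (simp add: F_def[abs_def] cauchy_product_def sum_distrib_right)
  qed
  have Gi: "has_bochner_integral lborel (G k) (cauchy_product (\<lambda>m. norm (c m)) (\<lambda>m. norm (d m)) k * ?p k)" for k
  proof -
    have "has_bochner_integral lborel (\<lambda>y. \<Sum>i\<le>k. norm (c i) * norm (d (k - i)) * P i (k - i) y)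
        (\<Sum>i\<le>k. norm (c i) * norm (d (k - i)) * ?p k)"
      by (intro has_bochner_integral_sum has_bochner_integral_mult_right P) auto
    then show ?thesis by (simp add: G_def[abs_def] cauchy_product_def sum_distrib_right)
  qed
  have FG: "norm (F k y) \<le> G k y" for k y
    unfolding F_def G_def by (rule order.trans[OF norm_sum]) (simp add: norm_mult P0)
  have point: "(\<lambda>k. F k y) sums (kernel_series \<alpha> \<beta> c (x - y) * kernel_series \<alpha> \<gamma> d y)" for y
  proof -
    have "(\<lambda>k. \<Sum>i\<le>k. (c i * of_real (frac_kernel (\<alpha> * real i + \<beta>) (x - y)))
          * (d (k - i) * of_real (frac_kernel (\<alpha> * real (k - i) + \<gamma>) y)))
        sums (kernel_series \<alpha> \<beta> c (x - y) * kernel_series \<alpha> \<gamma> d y)"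
      unfolding kernel_series_def
      by (intro Cauchy_product_sums summable_kernel_series \<alpha> \<beta> \<gamma> c d)
    then show ?thesis by (simp add: F_def P_def algebra_simps)
  qed
  have sumG: "summable (\<lambda>k. G k y)" for y
  proof -
    have "summable (\<lambda>k. \<Sum>i\<le>k. norm (c i * of_real (frac_kernel (\<alpha> * real i + \<beta>) (x - y)))
          * norm (d (k - i) * of_real (frac_kernel (\<alpha> * real (k - i) + \<gamma>) y)))"
      by (rule summable_Cauchy_product)
         (simp_all add: summable_kernel_series \<alpha> \<beta> \<gamma> c d)
    moreover have "norm (c i * of_real (frac_kernel (\<alpha> * real i + \<beta>) (x - y)))
          * norm (d j * of_real (frac_kernel (\<alpha> * real j + \<gamma>) y)) = norm (c i) * norm (d j) * P i j y" for i j
      using frac_kernel_nonneg[OF pos(1)[of i], of "x - y"] frac_kernel_nonneg[OF pos(2)[of j], of y]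
      by (simp add: P_def norm_mult)
    ultimately show ?thesis unfolding G_def by (simp only:)
  qed
  have S: "summable (\<lambda>k. cauchy_product (\<lambda>m. norm (c m)) (\<lambda>m. norm (d m)) k * ?p k)"
    using summable_kernel_series[of \<alpha> "\<beta> + \<gamma>" "cauchy_product (\<lambda>m. norm (c m)) (\<lambda>m. norm (d m))" x] \<alpha> \<beta> \<gamma>
    by (simp add: c d geometric_growth_norm geometric_growth_cauchy_product summable_rabs_cancel)
  have 1: "integrable lborel (F k)" for k
    using Fi[of k] by (simp add: has_bochner_integral_iff)
  have 2: "AE y in lborel. summable (\<lambda>k. norm (F k y))"
  proof (rule AE_I2)
    fix y
    show "summable (\<lambda>k. norm (F k y))"
      by (rule summable_comparison_test'[OF sumG[of y], of 0]) (simp add: FG)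
  qed
  have 3: "summable (\<lambda>k. \<integral>y. norm (F k y) \<partial>lborel)"
  proof (rule summable_comparison_test'[OF S, of 0])
    fix k
    have "(\<integral>y. norm (F k y) \<partial>lborel) \<le> (\<integral>y. G k y \<partial>lborel)"
      using 1[of k] Gi[of k] FG by (intro integral_mono) (auto simp: has_bochner_integral_iff)
    then show "norm (\<integral>y. norm (F k y) \<partial>lborel)
        \<le> cauchy_product (\<lambda>m. norm (c m)) (\<lambda>m. norm (d m)) k * ?p k"
      using Gi[of k] by (simp add: has_bochner_integral_iff)
  qed
  have "(\<lambda>y. \<Sum>k. F k y) = (\<lambda>y. kernel_series \<alpha> \<beta> c (x - y) * kernel_series \<alpha> \<gamma> d y)"
    using point by (simp add: fun_eq_iff sums_iff)
  moreover have "(\<Sum>k. integral\<^sup>L lborel (F k)) = kernel_series \<alpha> (\<beta> + \<gamma>) (cauchy_product c d) x"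
    using Fi by (simp add: kernel_series_def has_bochner_integral_iff)
  ultimately show ?thesis
    using integrable_suminf[OF 1 2 3] integral_suminf[OF 1 2 3] by (simp add: has_bochner_integral_iff)
qed



section \<open>Positivity of the interarrival density\<close>

text \<open>
  The density \<open>\<lambda> x\<^sup>\<alpha>\<^sup>-\<^sup>1 E\<^sub>\<alpha>\<^sub>,\<^sub>\<alpha>(-\<lambda> x\<^sup>\<alpha>)\<close> of the Mittag-Leffler law. Its Laplace transform is
  \<open>\<lambda> / (\<lambda> + p\<^sup>\<alpha>)\<close>, and the interarrival law is its convolution square.
\<close>

definition ml_density :: "real \<Rightarrow> real \<Rightarrow> real \<Rightarrow> real" where
  "ml_density lam \<alpha> = kernel_series \<alpha> \<alpha> (\<lambda>m. lam * (- lam) ^ m)"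

lemma kernel_series_tail:
  fixes c :: "nat \<Rightarrow> 'a::{real_normed_field,banach}"
  assumes "0 < \<alpha>" "0 < \<beta>" "geometric_growth c"
  shows "kernel_series \<alpha> \<beta> c x = c 0 * of_real (frac_kernel \<beta> x) + kernel_series \<alpha> (\<beta> + \<alpha>) (\<lambda>m. c (Suc m)) x"
  using suminf_split_head[OF summable_norm_cancel[OF summable_kernel_series[OF assms, of x]]]
  unfolding kernel_series_def by (simp add: algebra_simps)

lemma kernel_series_eq_powser:
  fixes c :: "nat \<Rightarrow> real"
  assumes "0 < \<alpha>" "0 < \<beta>" "geometric_growth c" "0 < x"
  shows "kernel_series \<alpha> \<beta> c x = x powr (\<beta> - 1) * (\<Sum>m. c m / Gamma (\<alpha> * real m + \<beta>) * (x powr \<alpha>) ^ m)"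
proof -
  have "summable (\<lambda>m. c m / Gamma (\<alpha> * real m + \<beta>) * (x powr \<alpha>) ^ m)"
  proof (rule summable_comparison_test')
    show "summable (\<lambda>m. norm (c m) * ((x powr \<alpha>) ^ m / Gamma (\<alpha> * real m + \<beta>)))"
      using assms by (intro summable_geometric_growth_div_Gamma) auto
    show "norm (c m / Gamma (\<alpha> * real m + \<beta>) * (x powr \<alpha>) ^ m)
        \<le> norm (c m) * ((x powr \<alpha>) ^ m / Gamma (\<alpha> * real m + \<beta>))" for m
      using assms Gamma_real_pos[of "\<alpha> * real m + \<beta>"]
      by (simp add: abs_mult add_nonneg_pos)
  qed
  moreover have "c m * of_real (frac_kernel (\<alpha> * real m + \<beta>) x)
      = x powr (\<beta> - 1) * (c m / Gamma (\<alpha> * real m + \<beta>) * (x powr \<alpha>) ^ m)" for m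
    by (simp add: frac_kernel_shift[OF \<open>0 < x\<close>])
  ultimately show ?thesis by (simp only: kernel_series_def suminf_mult)
qed

lemma powser_div_Gamma_continuous:
  fixes c :: "nat \<Rightarrow> 'a::{real_normed_field,banach}"
  assumes "0 < \<alpha>" "0 < \<beta>" "geometric_growth c"
  shows "isCont (\<lambda>z. \<Sum>m. c m / of_real (Gamma (\<alpha> * real m + \<beta>)) * z ^ m) z"
proof (rule isCont_powser_converges_everywhere)
  fix y :: 'a
  show "summable (\<lambda>m. c m / of_real (Gamma (\<alpha> * real m + \<beta>)) * y ^ m)"
  proof (rule summable_comparison_test')
    show "summable (\<lambda>m. norm (c m) * (norm y ^ m / Gamma (\<alpha> * real m + \<beta>)))"
      using assms by (intro summable_geometric_growth_div_Gamma) auto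
    show "norm (c m / of_real (Gamma (\<alpha> * real m + \<beta>)) * y ^ m)
        \<le> norm (c m) * (norm y ^ m / Gamma (\<alpha> * real m + \<beta>))" for m
      using assms Gamma_real_pos[of "\<alpha> * real m + \<beta>"]
      by (simp add: norm_mult norm_divide norm_power add_nonneg_pos)
  qed
qed

lemma ml_density_growth: "geometric_growth (\<lambda>m. (lam::real) * (- lam) ^ m)"
  by (intro geometric_growth_cmult geometric_growth_power)

lemma ml_density_nonpos: "x \<le> 0 \<Longrightarrow> ml_density lam \<alpha> x = 0"
  by (simp add: ml_density_def kernel_series_def frac_kernel_def)

text \<open>
  The identity \<open>w \<cdot> w / (1 + w) = w - w / (1 + w)\<close> in terms of kernels: the density is the resolvent of the
  kernel \<open>\<lambda> p\<^sub>\<alpha>\<close>.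
\<close>

lemma ml_density_volterra:
  assumes \<alpha>: "0 < \<alpha>"
  shows "has_bochner_integral lborel (\<lambda>y. (lam * frac_kernel \<alpha> (x - y)) * ml_density lam \<alpha> y)
           (lam * frac_kernel \<alpha> x - ml_density lam \<alpha> x)"
proof -
  define c where "c = (\<lambda>m. lam * (- lam) ^ m)"
  define e where "e = (\<lambda>m::nat. if m = 0 then lam else 0)"
  have c: "geometric_growth c" unfolding c_def by (rule ml_density_growth)
  have e: "geometric_growth e"
    by (rule geometric_growthI[of "\<bar>lam\<bar>" 1]) (auto simp: e_def)
  have "kernel_series \<alpha> \<alpha> e = (\<lambda>x. lam * frac_kernel \<alpha> x)"
  proof
    fix x
    have "kernel_series \<alpha> \<alpha> e x = (\<Sum>m\<in>{0}. e m * frac_kernel (\<alpha> * real m + \<alpha>) x)"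
      unfolding kernel_series_def by (subst suminf_finite[of "{0}"]) (auto simp: e_def)
    then show "kernel_series \<alpha> \<alpha> e x = lam * frac_kernel \<alpha> x" by (simp add: e_def)
  qed
  moreover have "cauchy_product e c = (\<lambda>m. lam * c m)"
  proof
    fix m
    have "cauchy_product e c m = (\<Sum>i\<in>{0}. e i * c (m - i))"
      unfolding cauchy_product_def by (rule sum.mono_neutral_right) (auto simp: e_def)
    then show "cauchy_product e c m = lam * c m" by (simp add: e_def)
  qed
  moreover have "kernel_series \<alpha> (\<alpha> + \<alpha>) (\<lambda>m. lam * c m) x = lam * frac_kernel \<alpha> x - kernel_series \<alpha> \<alpha> c x"
  proof -
    have "(\<lambda>m. c (Suc m)) = (\<lambda>m. - (lam * c m))" by (simp add: c_def)
    then have "kernel_series \<alpha> \<alpha> c x = lam * frac_kernel \<alpha> x + kernel_series \<alpha> (\<alpha> + \<alpha>) (\<lambda>m. - (lam * c m)) x"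
      using kernel_series_tail[OF \<alpha> \<alpha> c, of x] by (simp add: c_def)
    moreover have "kernel_series \<alpha> (\<alpha> + \<alpha>) (\<lambda>m. - (lam * c m)) x = - kernel_series \<alpha> (\<alpha> + \<alpha>) (\<lambda>m. lam * c m) x"
      unfolding kernel_series_def
      using \<alpha> summable_norm_cancel[OF summable_kernel_series[of \<alpha> "\<alpha> + \<alpha>" "\<lambda>m. lam * c m" x]] geometric_growth_cmult[OF c, of lam]
      by (subst suminf_minus[symmetric]) auto
    ultimately show ?thesis by simp
  qed
  ultimately show ?thesis
    using kernel_series_convolution[OF \<alpha> \<alpha> \<alpha> e c, of x] by (simp add: ml_density_def c_def)
qed

text \<open>
  Log-convexity of \<open>p\<^sub>\<alpha>\<close>: for fixed increment \<open>x0 - x1\<close>, the ratio \<open>p\<^sub>\<alpha>(x0 - y) / p\<^sub>\<alpha>(x1 - y)\<close> is largest at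
  \<open>y = 0\<close>.
\<close>

lemma frac_kernel_ratio:
  assumes "0 < \<alpha>" "\<alpha> \<le> 1" "0 < y" "y < x1" "x1 < x0"
  shows "frac_kernel \<alpha> (x0 - y) \<le> frac_kernel \<alpha> x0 / frac_kernel \<alpha> x1 * frac_kernel \<alpha> (x1 - y)"
proof -
  have G: "0 < Gamma \<alpha>" using assms by (simp add: Gamma_real_pos)
  have "(x0 - y) powr (\<alpha> - 1) * x1 powr (\<alpha> - 1) = ((x0 - y) * x1) powr (\<alpha> - 1)"
    using assms by (simp add: powr_mult)
  also have "\<dots> \<le> (x0 * (x1 - y)) powr (\<alpha> - 1)"
  proof (rule powr_mono2')
    have "x1 * y \<le> x0 * y" using assms by (intro mult_right_mono) auto
    then show "x0 * (x1 - y) \<le> (x0 - y) * x1" by (simp add: algebra_simps)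
  qed (use assms in auto)
  also have "\<dots> = x0 powr (\<alpha> - 1) * (x1 - y) powr (\<alpha> - 1)"
    using assms by (simp add: powr_mult)
  finally show ?thesis
    using assms G by (simp add: frac_kernel_def field_simps)
qed

text \<open>
  The resolvent of a log-convex nonincreasing kernel is positive. Otherwise let \<open>x0\<close> be the first point
  where \<open>\<psi> \<le> 0\<close>, and let \<open>x1 < x0\<close> be close to it. In \<open>\<psi>(x0) = k(x0) - (k * \<psi>)(x0)\<close>, log-convexity bounds
  the part of the convolution over \<open>y < x1\<close> by \<open>\<rho> (k(x1) - \<psi>(x1))\<close> with \<open>\<rho> = k(x0) / k(x1)\<close>, which leaves
  \<open>\<psi>(x0) \<ge> \<rho> \<psi>(x1)\<close> up to the contribution of \<open>{x1..x0}\<close>. If \<open>x1\<close> maximises \<open>\<psi>\<close> on a short interval ending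
  at \<open>x0\<close>, that contribution is less than \<open>\<psi>(x1) / 2\<close>, whereas \<open>\<rho> \<ge> 1/2\<close>. Hence \<open>\<psi>(x0) > 0\<close>.
\<close>

lemma ml_density_pos:
  assumes lam: "0 < lam" and \<alpha>: "0 < \<alpha>" "\<alpha> \<le> 1" and x: "0 < x"
  shows "0 < ml_density lam \<alpha> x"
proof (rule ccontr)
  assume neg: "\<not> 0 < ml_density lam \<alpha> x"
  let ?\<psi> = "ml_density lam \<alpha>"
  define e where "e z = (\<Sum>m. lam * (- lam) ^ m / Gamma (\<alpha> * real m + \<alpha>) * z ^ m)" for z
  have \<psi>: "?\<psi> y = y powr (\<alpha> - 1) * e (y powr \<alpha>)" if "0 < y" for y
    unfolding ml_density_def e_def by (rule kernel_series_eq_powser[OF \<alpha>(1) \<alpha>(1) ml_density_growth that])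
  have econt: "isCont e z" for z
    using powser_div_Gamma_continuous[OF \<alpha>(1) \<alpha>(1) ml_density_growth[of lam], of z] by (simp add: e_def[abs_def])
  have \<psi>cont: "continuous_on {0<..} ?\<psi>"
  proof -
    have "continuous_on {0<..} (\<lambda>y. y powr (\<alpha> - 1) * e (y powr \<alpha>))"
      by (intro continuous_intros continuous_on_compose2[OF continuous_at_imp_continuous_on[of UNIV e]])
         (auto simp: econt)
    then show ?thesis by (rule continuous_on_eq) (simp add: \<psi>)
  qed
  obtain \<eta> where \<eta>: "0 < \<eta>" "\<And>y. 0 < y \<Longrightarrow> y < \<eta> \<Longrightarrow> 0 < ?\<psi> y"
  proof -
    have "e 0 = lam / Gamma \<alpha>" unfolding e_def by (subst suminf_finite[of "{0}"]) auto
    then have e0: "0 < e 0" using lam \<alpha> by (simp add: Gamma_real_pos)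
    have "((\<lambda>y. e (y powr \<alpha>)) \<longlongrightarrow> e 0) (at_right 0)"
      by (rule isCont_tendsto_compose[OF econt]) (use \<alpha> in real_asymp)
    then have "\<forall>\<^sub>F y in at_right 0. 0 < e (y powr \<alpha>)"
      using e0 by (rule order_tendstoD)
    then show ?thesis
      using that \<psi> by (auto simp: eventually_at_right_field)
  qed
  define Z where "Z = {y \<in> {\<eta>..x}. ?\<psi> y \<le> 0}"
  have "compact Z"
  proof -
    have "closed ({\<eta>..x} \<inter> ?\<psi> -` {..0})"
      by (intro continuous_closed_preimage continuous_on_subset[OF \<psi>cont]) (use \<eta> in auto)
    moreover have "Z = {\<eta>..x} \<inter> ?\<psi> -` {..0}" by (auto simp: Z_def)
    ultimately have "closed Z" by simp
    moreover have "Z \<subseteq> {\<eta>..x}" by (auto simp: Z_def)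
    ultimately show ?thesis by (meson bounded_closed_interval bounded_subset compact_eq_bounded_closed)
  qed
  moreover have "x \<in> Z" using neg \<eta>(2)[OF x] by (force simp: Z_def)
  ultimately obtain x0 where x0: "x0 \<in> Z" "\<And>y. y \<in> Z \<Longrightarrow> x0 \<le> y"
    by (metis compact_attains_inf empty_iff)
  have x0pos: "0 < x0" and \<psi>x0: "?\<psi> x0 \<le> 0" using x0 \<eta> by (auto simp: Z_def)
  have before: "0 < ?\<psi> y" if "0 < y" "y < x0" for y
    using \<eta>(2)[of y] x0(1) x0(2)[of y] that by (force simp: Z_def)
  \<comment> \<open>\<open>\<delta> \<le> x0 / 2\<close> gives \<open>\<rho> \<ge> 1/2\<close>; the other bound says that \<open>k\<close> has mass less than \<open>1/2\<close> on \<open>{0..\<delta>}\<close>.\<close>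
  obtain \<delta> where \<delta>: "0 < \<delta>" "\<delta> \<le> x0 / 2" "lam * frac_kernel (\<alpha> + 1) \<delta> < 1 / 2"
  proof -
    have "((\<lambda>d. d powr \<alpha>) \<longlongrightarrow> 0) (at_right 0)"
      using \<alpha> by real_asymp
    from tendsto_mult_left[OF this, of "lam / Gamma (\<alpha> + 1)"]
    have "((\<lambda>d. lam * (d powr \<alpha> / Gamma (\<alpha> + 1))) \<longlongrightarrow> 0) (at_right 0)" by simp
    then have "\<forall>\<^sub>F d in at_right 0. lam * (d powr \<alpha> / Gamma (\<alpha> + 1)) < 1 / 2"
      by (rule order_tendstoD) simp
    then obtain b where b: "0 < b" "\<And>d. 0 < d \<Longrightarrow> d < b \<Longrightarrow> lam * (d powr \<alpha> / Gamma (\<alpha> + 1)) < 1 / 2"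
      by (auto simp: eventually_at_right_field)
    show ?thesis
      using b(2)[of "min (b / 2) (x0 / 2)"] b(1) x0pos
      by (intro that[of "min (b / 2) (x0 / 2)"]) (auto simp: frac_kernel_def)
  qed
  obtain x1 where x1: "x1 \<in> {x0 - \<delta>..x0}" "\<And>y. y \<in> {x0 - \<delta>..x0} \<Longrightarrow> ?\<psi> y \<le> ?\<psi> x1"
  proof -
    have "\<exists>x1\<in>{x0 - \<delta>..x0}. \<forall>y\<in>{x0 - \<delta>..x0}. ?\<psi> y \<le> ?\<psi> x1"
      by (rule continuous_attains_sup) (use \<delta> x0pos in \<open>auto intro: continuous_on_subset[OF \<psi>cont]\<close>)
    then show ?thesis using that by blast
  qed
  have \<psi>x1: "0 < ?\<psi> x1"
    using before[of "x0 - \<delta>"] x1(2)[of "x0 - \<delta>"] \<delta> x0pos by auto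
  have x1': "0 < x1" "x1 < x0" "x0 / 2 \<le> x1" "x0 - x1 \<le> \<delta>"
    using x1(1) \<psi>x0 \<psi>x1 \<delta> x0pos by (auto simp: less_le)
  define \<rho> where "\<rho> = frac_kernel \<alpha> x0 / frac_kernel \<alpha> x1"
  have \<rho>: "1 / 2 \<le> \<rho>"
  proof -
    have "\<rho> = (x1 / x0) powr (1 - \<alpha>)"
      using x1' x0pos Gamma_real_pos[OF \<alpha>(1)]
      by (simp add: \<rho>_def frac_kernel_def powr_divide powr_diff)
    also have "(x1 / x0) powr 1 \<le> (x1 / x0) powr (1 - \<alpha>)"
      using x1' x0pos \<alpha> by (intro powr_mono') auto
    finally have "x1 / x0 \<le> \<rho>" using x1' x0pos by simp
    moreover have "1 / 2 \<le> x1 / x0" using x1' x0pos by (simp add: field_simps)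
    ultimately show ?thesis by linarith
  qed
  have k1: "frac_kernel \<alpha> x1 \<noteq> 0"
    using x1' Gamma_real_pos[OF \<alpha>(1)] by (simp add: frac_kernel_def)
  have tail: "has_bochner_integral lborel (\<lambda>y. frac_kernel \<alpha> (x0 - y) * frac_kernel 1 (y - x1))
      (frac_kernel (\<alpha> + 1) (x0 - x1))"
    using frac_kernel_convolution[OF \<alpha>(1), of 1 "x0 - x1"]
    by (subst lborel_has_bochner_integral_real_affine_iff[of 1 _ _ x1]) (simp_all add: algebra_simps)
  note V0 = ml_density_volterra[OF \<alpha>(1), of lam x0] and V1 = ml_density_volterra[OF \<alpha>(1), of lam x1]
  have R: "has_bochner_integral lborel
      (\<lambda>y. \<rho> * (lam * frac_kernel \<alpha> (x1 - y) * ?\<psi> y) + ?\<psi> x1 * lam * (frac_kernel \<alpha> (x0 - y) * frac_kernel 1 (y - x1)))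
      (\<rho> * (lam * frac_kernel \<alpha> x1 - ?\<psi> x1) + ?\<psi> x1 * lam * frac_kernel (\<alpha> + 1) (x0 - x1))"
    by (intro has_bochner_integral_add has_bochner_integral_mult_right V1 tail)
  have "lam * frac_kernel \<alpha> x0 - ?\<psi> x0
      \<le> \<rho> * (lam * frac_kernel \<alpha> x1 - ?\<psi> x1) + ?\<psi> x1 * lam * frac_kernel (\<alpha> + 1) (x0 - x1)"
  proof -
    have "(\<integral>y. lam * frac_kernel \<alpha> (x0 - y) * ?\<psi> y \<partial>lborel)
        \<le> (\<integral>y. \<rho> * (lam * frac_kernel \<alpha> (x1 - y) * ?\<psi> y) + ?\<psi> x1 * lam * (frac_kernel \<alpha> (x0 - y) * frac_kernel 1 (y - x1)) \<partial>lborel)"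
    proof (rule integral_mono_AE)
      show "AE y in lborel. lam * frac_kernel \<alpha> (x0 - y) * ?\<psi> y
          \<le> \<rho> * (lam * frac_kernel \<alpha> (x1 - y) * ?\<psi> y) + ?\<psi> x1 * lam * (frac_kernel \<alpha> (x0 - y) * frac_kernel 1 (y - x1))"
        \<comment> \<open>At \<open>y = x1\<close> both terms of the bound vanish, so it holds only almost everywhere.\<close>
        using AE_lborel_singleton[of x1]
      proof eventually_elim
        case (elim y)
        consider "y \<le> 0" | "0 < y" "y < x1" | "x1 < y" "y < x0" | "x0 \<le> y" using elim by linarith
        then show ?case
        proof cases
          case 1
          then show ?thesis using x1' by (simp add: ml_density_nonpos frac_kernel_def)
        next
          case 2
          then have "frac_kernel \<alpha> (x0 - y) * (lam * ?\<psi> y) \<le> \<rho> * frac_kernel \<alpha> (x1 - y) * (lam * ?\<psi> y)"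
            using frac_kernel_ratio[OF \<alpha> 2 x1'(2)] before[of y] lam x1'
            by (intro mult_right_mono) (auto simp: \<rho>_def)
          moreover have "frac_kernel 1 (y - x1) = 0" using 2 by (simp add: frac_kernel_def)
          ultimately show ?thesis by (simp add: algebra_simps)
        next
          case 3
          then have "?\<psi> y \<le> ?\<psi> x1" using x1(1) by (intro x1(2)) auto
          then have "lam * frac_kernel \<alpha> (x0 - y) * ?\<psi> y \<le> lam * frac_kernel \<alpha> (x0 - y) * ?\<psi> x1"
            using lam \<alpha> by (intro mult_left_mono) (auto simp: frac_kernel_nonneg)
          moreover have "frac_kernel \<alpha> (x1 - y) = 0" "frac_kernel 1 (y - x1) = 1"
            using 3 by (simp_all add: frac_kernel_def)
          ultimately show ?thesis by (simp add: algebra_simps)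
        next
          case 4
          then show ?thesis using x1' by (simp add: frac_kernel_def)
        qed
      qed
    qed (use V0 R in \<open>simp_all add: has_bochner_integral_iff\<close>)
    then show ?thesis using V0 R by (simp add: has_bochner_integral_iff)
  qed
  moreover have "\<rho> * (lam * frac_kernel \<alpha> x1) = lam * frac_kernel \<alpha> x0"
    using k1 by (simp add: \<rho>_def)
  ultimately have "?\<psi> x1 * \<rho> \<le> ?\<psi> x1 * (lam * frac_kernel (\<alpha> + 1) (x0 - x1))"
    using \<psi>x0 by (simp add: algebra_simps)
  then have "\<rho> \<le> lam * frac_kernel (\<alpha> + 1) (x0 - x1)"
    using \<psi>x1 by simp
  also have "\<dots> \<le> lam * frac_kernel (\<alpha> + 1) \<delta>"
    using x1' \<delta> lam \<alpha> Gamma_real_pos[of "\<alpha> + 1"]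
    by (intro mult_left_mono) (auto simp: frac_kernel_def intro!: divide_right_mono powr_mono2)
  finally show False using \<rho> \<delta>(3) by linarith
qed

text \<open>
  The coefficients of \<open>\<lambda>\<^sup>2 / (1 + \<lambda> X)\<^sup>2\<close>; the factor \<open>X\<^sup>2\<close> is accounted for by the index \<open>2 \<alpha>\<close> of the kernel
  series.
\<close>

definition interarrival_coeff :: "real \<Rightarrow> nat \<Rightarrow> real" where
  "interarrival_coeff lam m = real (m + 1) * (lam\<^sup>2 * (- lam) ^ m)"

lemma interarrival_coeff_cauchy:
  "interarrival_coeff lam = cauchy_product (\<lambda>m. lam * (- lam) ^ m) (\<lambda>m. lam * (- lam) ^ m)"
proof
  fix m
  have "cauchy_product (\<lambda>m. lam * (- lam) ^ m) (\<lambda>m. lam * (- lam) ^ m) m = (\<Sum>i\<le>m. lam\<^sup>2 * (- lam) ^ m)"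
    unfolding cauchy_product_def
  proof (intro sum.cong refl)
    fix i assume "i \<in> {..m}"
    then have "(- lam) ^ m = (- lam) ^ i * (- lam) ^ (m - i)" by (simp flip: power_add)
    then show "lam * (- lam) ^ i * (lam * (- lam) ^ (m - i)) = lam\<^sup>2 * (- lam) ^ m"
      by (simp add: power2_eq_square)
  qed
  then show "interarrival_coeff lam m = cauchy_product (\<lambda>m. lam * (- lam) ^ m) (\<lambda>m. lam * (- lam) ^ m) m"
    by (simp add: interarrival_coeff_def algebra_simps)
qed

lemma interarrival_coeff_growth: "geometric_growth (interarrival_coeff lam)"
  unfolding interarrival_coeff_cauchy by (intro geometric_growth_cauchy_product ml_density_growth)

lemma interarrival_density_eq_kernel_series:
  assumes \<alpha>: "0 < \<alpha>"
  shows "interarrival_density lam \<alpha> = kernel_series \<alpha> (2 * \<alpha>) (interarrival_coeff lam)"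
proof
  fix x
  show "interarrival_density lam \<alpha> x = kernel_series \<alpha> (2 * \<alpha>) (interarrival_coeff lam) x"
  proof (cases "0 < x")
    case False
    then show ?thesis by (simp add: interarrival_density_def kernel_series_def frac_kernel_def)
  next
    case True
    have "(1::real) / Gamma 2 * (\<Sum>j. Gamma (real j + 2) * (- lam * x powr \<alpha>) ^ j / (fact j * Gamma (real j * \<alpha> + 2 * \<alpha>)))
        = (\<Sum>j. real (j + 1) * (- lam) ^ j / Gamma (\<alpha> * real j + 2 * \<alpha>) * (x powr \<alpha>) ^ j)"
    proof -
      have "Gamma (real j + 2) = real (j + 1) * fact j" for j
        using Gamma_fact[of "Suc j", where 'a = real] by (simp add: algebra_simps)
      moreover have "Gamma 2 = (1::real)" using Gamma_fact[of 1, where 'a = real] by simp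
      moreover have "(- lam * x powr \<alpha>) ^ j = (- lam) ^ j * (x powr \<alpha>) ^ j" for j
        by (simp only: power_mult_distrib)
      ultimately show ?thesis by (simp add: mult.commute[of _ \<alpha>] mult.assoc del: mult_minus_left mult_minus_right)
    qed
    moreover have "summable (\<lambda>j. real (j + 1) * (- lam) ^ j / Gamma (\<alpha> * real j + 2 * \<alpha>) * (x powr \<alpha>) ^ j)"
    proof (cases "lam = 0")
      case True
      have "summable (\<lambda>j. if j = 0 then inverse (Gamma (2 * \<alpha>)) else 0)"
        by simp
      moreover have "(\<lambda>j. real (j + 1) * (- lam) ^ j / Gamma (\<alpha> * real j + 2 * \<alpha>) * (x powr \<alpha>) ^ j)
          = (\<lambda>j. if j = 0 then inverse (Gamma (2 * \<alpha>)) else 0)"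
        using True by (auto simp: fun_eq_iff divide_inverse)
      ultimately show ?thesis by simp
    next
      case False
      have "summable (\<lambda>m. norm (interarrival_coeff lam m) * ((x powr \<alpha>) ^ m / Gamma (\<alpha> * real m + 2 * \<alpha>)))"
        using \<alpha> interarrival_coeff_growth by (intro summable_geometric_growth_div_Gamma) auto
      from summable_mult[OF this, of "1 / lam\<^sup>2"] show ?thesis
        by (rule summable_comparison_test') 
           (use False \<alpha> in \<open>auto simp: interarrival_coeff_def abs_mult Gamma_real_pos abs_of_pos add_nonneg_pos\<close>)
    qed
    moreover have "interarrival_coeff lam j / Gamma (\<alpha> * real j + 2 * \<alpha>) * (x powr \<alpha>) ^ j
        = lam\<^sup>2 * (real (j + 1) * (- lam) ^ j / Gamma (\<alpha> * real j + 2 * \<alpha>) * (x powr \<alpha>) ^ j)" for j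
      by (simp add: interarrival_coeff_def)
    ultimately have "kernel_series \<alpha> (2 * \<alpha>) (interarrival_coeff lam) x
        = x powr (2 * \<alpha> - 1) * (lam\<^sup>2 * (1 / Gamma 2 * (\<Sum>j. Gamma (real j + 2) * (- lam * x powr \<alpha>) ^ j / (fact j * Gamma (real j * \<alpha> + 2 * \<alpha>)))))"
      using kernel_series_eq_powser[OF \<alpha> _ interarrival_coeff_growth True, of "2 * \<alpha>" lam] \<alpha>
      by (simp only: suminf_mult zero_less_numeral mult_pos_pos)
    then show ?thesis
      using True by (simp add: interarrival_density_def mittag_leffler3_def)
  qed
qed

lemma interarrival_density_measurable:
  assumes "0 < \<alpha>"
  shows "interarrival_density lam \<alpha> \<in> borel_measurable borel"
  unfolding interarrival_density_eq_kernel_series[OF assms] by measurable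

lemma interarrival_density_nonneg:
  assumes "0 < lam" "0 < \<alpha>" "\<alpha> \<le> 1"
  shows "0 \<le> interarrival_density lam \<alpha> x"
proof -
  have "has_bochner_integral lborel (\<lambda>y. ml_density lam \<alpha> (x - y) * ml_density lam \<alpha> y) (interarrival_density lam \<alpha> x)"
    using kernel_series_convolution[OF assms(2) assms(2) assms(2) ml_density_growth[of lam] ml_density_growth[of lam], where x = x]
    by (simp add: interarrival_density_eq_kernel_series[OF assms(2)] interarrival_coeff_cauchy ml_density_def)
  moreover have "0 \<le> ml_density lam \<alpha> y" for y
    using ml_density_pos[OF assms, of y] ml_density_nonpos[of y lam \<alpha>] by (cases "0 < y") auto
  ultimately show ?thesis
    unfolding has_bochner_integral_iff by (metis (lifting) Bochner_Integration.integral_nonneg mult_nonneg_nonneg)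
qed



section \<open>The renewal equation\<close>

definition mittag_leffler :: "real \<Rightarrow> complex \<Rightarrow> complex" where
  "mittag_leffler \<alpha> z = (\<Sum>m. z ^ m / of_real (Gamma (\<alpha> * real m + 1)))"

text \<open>
  The closed form of \<open>E(u ^ N(x))\<close> for \<open>u = s\<^sup>2\<close>.
\<close>

definition renewal_pgf :: "real \<Rightarrow> real \<Rightarrow> complex \<Rightarrow> real \<Rightarrow> complex" where
  "renewal_pgf lam \<alpha> s x =
     (s + 1) / (2 * s) * mittag_leffler \<alpha> (- (of_real lam * (1 - s)) * of_real (x powr \<alpha>)) +
     (s - 1) / (2 * s) * mittag_leffler \<alpha> (- (of_real lam * (1 + s)) * of_real (x powr \<alpha>))"

lemma cauchy_product_eq_fps_mult:
  fixes c d :: "nat \<Rightarrow> 'a::comm_semiring_0"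
  shows "Abs_fps (cauchy_product c d) = Abs_fps c * Abs_fps d"
  by (intro fps_ext) (simp add: cauchy_product_def fps_mult_nth atLeast0AtMost)

lemma cauchy_product_assoc_commute:
  fixes b c d :: "nat \<Rightarrow> 'a::comm_semiring_0"
  shows "cauchy_product d (cauchy_product b c) = cauchy_product b (cauchy_product c d)"
proof -
  have "Abs_fps (cauchy_product d (cauchy_product b c)) = Abs_fps (cauchy_product b (cauchy_product c d))"
    by (simp add: cauchy_product_eq_fps_mult mult_ac)
  then show ?thesis by (simp add: Abs_fps_inject)
qed

text \<open>
  Multiplication by \<open>l / (1 + l X)\<close> is characterised by a first-order recurrence, so a product with it is
  identified by checking the recurrence.
\<close>

lemma cauchy_product_geometric_unique:
  fixes d g :: "nat \<Rightarrow> complex"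
  assumes "d 0 = l * g 0" "\<And>m. d (Suc m) = l * g (Suc m) - l * d m"
  shows "cauchy_product (\<lambda>m. l * (- l) ^ m) g = d"
proof
  fix m
  show "cauchy_product (\<lambda>m. l * (- l) ^ m) g m = d m"
  proof (induction m)
    case 0
    then show ?case by (simp add: cauchy_product_def assms)
  next
    case (Suc m)
    have "cauchy_product (\<lambda>m. l * (- l) ^ m) g (Suc m)
        = l * g (Suc m) - l * cauchy_product (\<lambda>m. l * (- l) ^ m) g m"
      unfolding cauchy_product_def sum.atMost_Suc_shift
      by (simp add: sum_distrib_left sum_negf algebra_simps)
    then show ?case by (simp add: Suc assms)
  qed
qed

lemma mittag_leffler_summable:
  assumes "0 < \<alpha>"
  shows "summable (\<lambda>m. norm (z ^ m / of_real (Gamma (\<alpha> * real m + 1)) :: complex))"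
proof -
  have "norm (z ^ m / of_real (Gamma (\<alpha> * real m + 1)) :: complex) = norm z ^ m / Gamma (\<alpha> * real m + 1)" for m
    using assms Gamma_real_pos[of "\<alpha> * real m + 1"] by (simp add: norm_divide norm_power add_nonneg_pos)
  then show ?thesis using summable_power_div_Gamma[of \<alpha> 1 "norm z"] assms by simp
qed

lemma mittag_leffler_cont:
  assumes "0 < \<alpha>"
  shows "isCont (mittag_leffler \<alpha>) z"
  using powser_div_Gamma_continuous[of \<alpha> 1 "\<lambda>m. 1 ^ m" z] geometric_growth_power[of "1::complex"] assms
  by (simp add: mittag_leffler_def[abs_def])

lemma mittag_leffler_0: "mittag_leffler \<alpha> 0 = 1"
  unfolding mittag_leffler_def by (subst suminf_finite[of "{0}"]) auto

lemma renewal_pgf_0: "s \<noteq> 0 \<Longrightarrow> renewal_pgf lam \<alpha> s 0 = 1"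
  by (simp add: renewal_pgf_def mittag_leffler_0 field_simps)

lemma renewal_pgf_cont:
  assumes "0 < \<alpha>"
  shows "continuous_on {0..} (renewal_pgf lam \<alpha> s)"
proof -
  have ml: "continuous_on UNIV (mittag_leffler \<alpha>)"
    using mittag_leffler_cont[OF assms] by (simp add: continuous_at_imp_continuous_on)
  have "continuous_on {0..} (\<lambda>x::real. x powr \<alpha>)"
    using assms by (intro continuous_on_powr' continuous_intros) auto
  then have "continuous_on {0..} (\<lambda>x. mittag_leffler \<alpha> (c * of_real (x powr \<alpha>)))" for c
    by (intro continuous_on_compose2[OF ml] continuous_on_mult continuous_on_const continuous_on_of_real) auto
  then show ?thesis
    unfolding renewal_pgf_def by (intro continuous_on_add continuous_on_mult continuous_on_const)
qed

lemma renewal_pgf_measurable: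
  assumes "0 < \<alpha>"
  shows "renewal_pgf lam \<alpha> s \<in> borel_measurable borel"
proof -
  have [measurable]: "mittag_leffler \<alpha> \<in> borel_measurable borel"
    using mittag_leffler_cont[OF assms]
    by (intro borel_measurable_continuous_onI continuous_at_imp_continuous_on) auto
  then show ?thesis unfolding renewal_pgf_def[abs_def] by measurable
qed

lemma kernel_series_of_real:
  assumes "0 < \<alpha>" "0 < \<beta>" "geometric_growth c"
  shows "kernel_series \<alpha> \<beta> (\<lambda>m. of_real (c m)) x = complex_of_real (kernel_series \<alpha> \<beta> c x)"
  using suminf_of_real[OF summable_norm_cancel[OF summable_kernel_series[OF assms, of x]], where 'a = complex]
  unfolding kernel_series_def by simp

text \<open>
  This is \<open>H - 1 = (u H - 1) * \<phi>\<close> for \<open>H = renewal_pgf lam \<alpha> s\<close> and \<open>u = s\<^sup>2\<close>, where \<open>H\<close> and 1 are cut off at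
  negative times. On coefficients it is an identity of rational functions: with
  \<open>h = A / (1 - z X) + B / (1 - w X)\<close> it says \<open>h - 1 = (\<lambda> X / (1 + \<lambda> X))\<^sup>2 (u h - 1)\<close>. The square is split
  into two multiplications by \<open>\<lambda> / (1 + \<lambda> X)\<close>, each of which is checked by its recurrence.
\<close>

lemma renewal_pgf_equation:
  assumes \<alpha>: "0 < \<alpha>" and s: "s \<noteq> 0"
  shows "has_bochner_integral lborel
           (\<lambda>y. interarrival_density lam \<alpha> y *\<^sub>R (if 0 \<le> x - y then s\<^sup>2 * renewal_pgf lam \<alpha> s (x - y) - 1 else 0))
           (if 0 \<le> x then renewal_pgf lam \<alpha> s x - 1 else 0)"
proof -
  define l where "l = complex_of_real lam"
  define A B where "A = (s + 1) / (2 * s)" and "B = (s - 1) / (2 * s)"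
  define z w where "z = - (l * (1 - s))" and "w = - (l * (1 + s))"
  define h where "h m = A * z ^ m + B * w ^ m" for m
  define e where "e m = (if m = 0 then 1 else 0 :: complex)" for m :: nat
  define g where "g m = s\<^sup>2 * h m + - 1 * e m" for m
  define c where "c m = l * (- l) ^ m" for m
  define q where "q m = complex_of_real (interarrival_coeff lam m)" for m
  have h: "geometric_growth h" unfolding h_def
    by (intro geometric_growth_add geometric_growth_cmult geometric_growth_power)
  have e: "geometric_growth e" by (rule geometric_growthI[of 1 1]) (auto simp: e_def)
  have g: "geometric_growth g" unfolding g_def
    by (intro geometric_growth_add geometric_growth_cmult h e)
  have q: "geometric_growth q"
    using interarrival_coeff_growth[of lam] by (simp add: q_def geometric_growth_def)
  have h01: "h 0 = 1" "h 1 = 0"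
    using s by (simp_all add: h_def A_def B_def z_def w_def field_simps)
  have zw: "z + l = l * s" "w + l = - (l * s)" by (simp_all add: z_def w_def algebra_simps)
  have "q = cauchy_product c c"
    unfolding q_def interarrival_coeff_cauchy
    by (simp add: cauchy_product_def[abs_def] c_def[abs_def] l_def)
  \<comment> \<open>First factor; the closed form comes from \<open>z + l = l s\<close> and \<open>w + l = - l s\<close>.\<close>
  moreover have "cauchy_product c g = (\<lambda>m. s * (A * z ^ Suc m - B * w ^ Suc m))"
    unfolding c_def
  proof (rule cauchy_product_geometric_unique)
    have "s * (A * z - B * w) = l * (s\<^sup>2 - 1)"
      using s by (simp add: A_def B_def z_def w_def field_simps power2_eq_square)
    then show "s * (A * z ^ Suc 0 - B * w ^ Suc 0) = l * g 0"
      by (simp add: g_def e_def h01)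
  next
    fix m
    have "s * (A * z ^ Suc (Suc m) - B * w ^ Suc (Suc m)) + l * (s * (A * z ^ Suc m - B * w ^ Suc m))
        = s * (A * z ^ Suc m * (z + l) - B * w ^ Suc m * (w + l))" by (simp add: algebra_simps)
    also have "\<dots> = l * g (Suc m)"
      unfolding zw by (simp add: g_def h_def e_def algebra_simps power2_eq_square)
    finally show "s * (A * z ^ Suc (Suc m) - B * w ^ Suc (Suc m))
        = l * g (Suc m) - l * (s * (A * z ^ Suc m - B * w ^ Suc m))" by (simp add: algebra_simps)
  qed
  moreover have "cauchy_product c (\<lambda>m. s * (A * z ^ Suc m - B * w ^ Suc m)) = (\<lambda>m. h (Suc (Suc m)))"
    unfolding c_def
  proof (rule cauchy_product_geometric_unique)
    have *: "h (Suc (Suc m)) + l * h (Suc m) = l * (s * (A * z ^ Suc m - B * w ^ Suc m))" for m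
    proof -
      have "h (Suc (Suc m)) + l * h (Suc m) = A * z ^ Suc m * (z + l) + B * w ^ Suc m * (w + l)"
        by (simp add: h_def algebra_simps)
      also have "\<dots> = l * (s * (A * z ^ Suc m - B * w ^ Suc m))"
        unfolding zw by (simp add: algebra_simps)
      finally show ?thesis .
    qed
    show "h (Suc (Suc 0)) = l * (s * (A * z ^ Suc 0 - B * w ^ Suc 0))"
      using *[of 0] h01(2) by simp
    show "h (Suc (Suc (Suc m))) = l * (s * (A * z ^ Suc (Suc m) - B * w ^ Suc (Suc m))) - l * h (Suc (Suc m))" for m
      using *[of "Suc m"] by (simp add: algebra_simps)
  qed
  ultimately have gq: "cauchy_product g q = (\<lambda>m. h (Suc (Suc m)))"
    using cauchy_product_assoc_commute[of g c c] by simp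
  have ks_h: "kernel_series \<alpha> 1 h y = renewal_pgf lam \<alpha> s y" if "0 < y" for y
  proof -
    have sz: "summable (\<lambda>m. A * ((z * of_real (y powr \<alpha>)) ^ m / of_real (Gamma (\<alpha> * real m + 1))))"
      and sw: "summable (\<lambda>m. B * ((w * of_real (y powr \<alpha>)) ^ m / of_real (Gamma (\<alpha> * real m + 1))))"
      by (intro summable_mult summable_norm_cancel[OF mittag_leffler_summable] \<alpha>)+
    have "h m * of_real (frac_kernel (\<alpha> * real m + 1) y)
        = A * ((z * of_real (y powr \<alpha>)) ^ m / of_real (Gamma (\<alpha> * real m + 1)))
        + B * ((w * of_real (y powr \<alpha>)) ^ m / of_real (Gamma (\<alpha> * real m + 1)))" for m
      unfolding frac_kernel_shift[OF that] using that
      by (simp add: h_def power_mult_distrib add_divide_distrib distrib_right mult.assoc)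
    then have "kernel_series \<alpha> 1 h y
        = (\<Sum>m. A * ((z * of_real (y powr \<alpha>)) ^ m / of_real (Gamma (\<alpha> * real m + 1))))
        + (\<Sum>m. B * ((w * of_real (y powr \<alpha>)) ^ m / of_real (Gamma (\<alpha> * real m + 1))))"
      unfolding kernel_series_def suminf_add[OF sz sw] by (simp only:)
    also have "\<dots> = A * mittag_leffler \<alpha> (z * of_real (y powr \<alpha>)) + B * mittag_leffler \<alpha> (w * of_real (y powr \<alpha>))"
      unfolding mittag_leffler_def
      by (simp only: suminf_mult[OF summable_norm_cancel[OF mittag_leffler_summable[OF \<alpha>]]])
    finally have "kernel_series \<alpha> 1 h y = A * mittag_leffler \<alpha> (z * of_real (y powr \<alpha>)) + B * mittag_leffler \<alpha> (w * of_real (y powr \<alpha>))" .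
    then show ?thesis by (simp add: renewal_pgf_def A_def B_def z_def w_def l_def)
  qed
  have ks_e: "kernel_series \<alpha> 1 e y = 1" if "0 < y" for y
    unfolding kernel_series_def using that
    by (subst suminf_finite[of "{0}"]) (auto simp: e_def frac_kernel_def)
  have ks_g: "kernel_series \<alpha> 1 g y = s\<^sup>2 * renewal_pgf lam \<alpha> s y - 1" if "0 < y" for y
  proof -
    have sh: "summable (\<lambda>m. h m * of_real (frac_kernel (\<alpha> * real m + 1) y))"
      and se: "summable (\<lambda>m. e m * of_real (frac_kernel (\<alpha> * real m + 1) y))"
      using summable_norm_cancel[OF summable_kernel_series[OF \<alpha> zero_less_one h]]
        summable_norm_cancel[OF summable_kernel_series[OF \<alpha> zero_less_one e]] by auto
    have "kernel_series \<alpha> 1 g y = s\<^sup>2 * kernel_series \<alpha> 1 h y - kernel_series \<alpha> 1 e y"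
      unfolding kernel_series_def suminf_mult[OF sh, symmetric] suminf_diff[OF summable_mult[OF sh] se]
      by (simp add: g_def algebra_simps)
    then show ?thesis using that by (simp add: ks_h ks_e)
  qed
  have neg: "kernel_series \<alpha> \<beta> d y = 0" if "y \<le> 0" for \<beta> y and d :: "nat \<Rightarrow> complex"
    using that by (simp add: kernel_series_def frac_kernel_def)
  have ks_q: "kernel_series \<alpha> (2 * \<alpha>) q y = of_real (interarrival_density lam \<alpha> y)" for y
    using kernel_series_of_real[of \<alpha> "2 * \<alpha>" "interarrival_coeff lam" y] \<alpha> interarrival_coeff_growth
    by (simp add: interarrival_density_eq_kernel_series q_def[abs_def])
  have ks_R: "kernel_series \<alpha> (1 + 2 * \<alpha>) (cauchy_product g q) x = (if 0 \<le> x then renewal_pgf lam \<alpha> s x - 1 else 0)"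
  proof -
    consider "x < 0" | "x = 0" | "0 < x" by linarith
    then show ?thesis
    proof cases
      case 3
      have gS: "geometric_growth (\<lambda>m. h (Suc m))"
        using geometric_growth_add[OF geometric_growth_cmult[OF geometric_growth_power, of "A * z" z]
            geometric_growth_cmult[OF geometric_growth_power, of "B * w" w]]
        by (simp add: h_def mult.assoc)
      show ?thesis
        using kernel_series_tail[OF \<alpha> zero_less_one h, of x] kernel_series_tail[OF \<alpha> _ gS, of "1 + \<alpha>" x] \<alpha> 3 h01
        by (simp add: gq ks_h frac_kernel_def algebra_simps)
    qed (use s in \<open>auto simp: neg renewal_pgf_0\<close>)
  qed
  have 1: "has_bochner_integral lborel
      (\<lambda>y. kernel_series \<alpha> 1 g (x - y) * kernel_series \<alpha> (2 * \<alpha>) q y)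
      (if 0 \<le> x then renewal_pgf lam \<alpha> s x - 1 else 0)"
    using kernel_series_convolution[OF \<alpha> zero_less_one _ g q, of "2 * \<alpha>" x] \<alpha> by (simp add: ks_R)
  \<comment> \<open>The kernel series vanishes at 0 whereas the cut-off function does not, hence a null set at \<open>y = x\<close>.\<close>
  have 2: "AE y in lborel. kernel_series \<alpha> 1 g (x - y) * kernel_series \<alpha> (2 * \<alpha>) q y
      = interarrival_density lam \<alpha> y *\<^sub>R (if 0 \<le> x - y then s\<^sup>2 * renewal_pgf lam \<alpha> s (x - y) - 1 else 0)"
    using AE_lborel_singleton[of x]
  proof eventually_elim
    case (elim y)
    then consider "x < y" | "y < x" by linarith
    then show ?case
      unfolding ks_q by cases (simp_all add: ks_g neg scaleR_conv_of_real)
  qed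
  note [measurable] = renewal_pgf_measurable[OF \<alpha>, of lam s] interarrival_density_measurable[OF \<alpha>, of lam]
  have 3: "(\<lambda>y. interarrival_density lam \<alpha> y *\<^sub>R (if 0 \<le> x - y then s\<^sup>2 * renewal_pgf lam \<alpha> s (x - y) - 1 else 0))
      \<in> borel_measurable lborel"
    by measurable
  show ?thesis
    by (rule has_bochner_integral_cong_AE[THEN iffD1, OF borel_measurable_has_bochner_integral[OF 1] 3 2 1])
qed



section \<open>The generating function at a fixed time\<close>

lemma renewal_pgf_bounded:
  assumes "0 < \<alpha>"
  shows "\<exists>B>0. \<forall>y\<in>{0..x}. norm (renewal_pgf lam \<alpha> s y) \<le> B"
proof -
  have "compact (renewal_pgf lam \<alpha> s ` {0..x})"
    by (intro compact_continuous_image continuous_on_subset[OF renewal_pgf_cont[OF assms]]) auto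
  from compact_imp_bounded[OF this] show ?thesis by (simp add: bounded_pos)
qed

text \<open>
  Fubini's theorem: condition on \<open>S\<close> and integrate out the independent summand \<open>X\<close> against its density.
\<close>

lemma (in prob_space) expectation_indep_density_sum:
  fixes G :: "real \<Rightarrow> 'c::{banach, second_countable_topology}" and \<phi> :: "real \<Rightarrow> real"
  assumes indep: "indep_var borel S borel X"
    and X: "distributed M lborel X (\<lambda>x. ennreal (\<phi> x))"
    and [measurable]: "\<phi> \<in> borel_measurable borel" and nonneg: "\<And>y. 0 \<le> \<phi> y"
    and [measurable]: "G \<in> borel_measurable borel" and bounded: "\<And>y. norm (G y) \<le> B"
  shows "expectation (\<lambda>\<omega>. G (x - (S \<omega> + X \<omega>))) = expectation (\<lambda>\<omega>. \<integral>y. \<phi> y *\<^sub>R G (x - S \<omega> - y) \<partial>lborel)"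
proof -
  have [measurable]: "random_variable borel S" "random_variable borel X"
    and joint: "distr M borel S \<Otimes>\<^sub>M distr M borel X = distr M (borel \<Otimes>\<^sub>M borel) (\<lambda>\<omega>. (S \<omega>, X \<omega>))"
    using indep unfolding indep_var_distribution_eq by auto
  interpret S: prob_space "distr M borel S" by (rule prob_space_distr) simp
  interpret X: prob_space "distr M borel X" by (rule prob_space_distr) simp
  interpret P: pair_prob_space "distr M borel S" "distr M borel X" ..
  have "expectation (\<lambda>\<omega>. G (x - (S \<omega> + X \<omega>)))
      = (\<integral>p. G (x - (fst p + snd p)) \<partial>(distr M borel S \<Otimes>\<^sub>M distr M borel X))"
    unfolding joint by (subst integral_distr) simp_all
  also have "\<dots> = (\<integral>s. \<integral>y. G (x - (s + y)) \<partial>distr M borel X \<partial>distr M borel S)"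
  proof -
    have "integrable (distr M borel S \<Otimes>\<^sub>M distr M borel X) (\<lambda>p. G (x - (fst p + snd p)))"
      by (rule P.integrable_const_bound[of _ B]) (simp_all add: bounded)
    from P.integral_fst'[OF this] show ?thesis by simp
  qed
  also have "\<dots> = (\<integral>s. \<integral>y. \<phi> y *\<^sub>R G (x - s - y) \<partial>lborel \<partial>distr M borel S)"
  proof (rule Bochner_Integration.integral_cong[OF refl])
    fix s
    have "distr M borel X = density lborel (\<lambda>x. ennreal (\<phi> x))"
      using distributed_distr_eq_density[OF X] by (simp cong: distr_cong)
    then have "(\<integral>y. G (x - (s + y)) \<partial>distr M borel X) = (\<integral>y. G (x - (s + y)) \<partial>density lborel (\<lambda>x. ennreal (\<phi> x)))"
      by simp
    also have "\<dots> = (\<integral>y. \<phi> y *\<^sub>R G (x - (s + y)) \<partial>lborel)"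
      using nonneg by (intro integral_density) simp_all
    finally show "(\<integral>y. G (x - (s + y)) \<partial>distr M borel X) = (\<integral>y. \<phi> y *\<^sub>R G (x - s - y) \<partial>lborel)"
      by (simp add: algebra_simps)
  qed
  also have "\<dots> = expectation (\<lambda>\<omega>. \<integral>y. \<phi> y *\<^sub>R G (x - S \<omega> - y) \<partial>lborel)"
    by (subst integral_distr) simp_all
  finally show ?thesis .
qed

lemma card_epochs_le:
  fixes S :: "nat \<Rightarrow> real"
  assumes "strict_mono S" "S n \<le> t" "t < S (Suc n)"
  shows "card {k. 1 \<le> k \<and> S k \<le> t} = n"
proof -
  have *: "S k \<le> t \<longleftrightarrow> k \<le> n" for k
  proof
    assume "S k \<le> t"
    then have "S k < S (Suc n)" using assms by linarith
    then show "k \<le> n" using assms(1) by (simp add: strict_mono_less)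
  next
    assume "k \<le> n"
    then have "S k \<le> S n" using assms(1) by (simp add: strict_mono_less_eq)
    then show "S k \<le> t" using assms by linarith
  qed
  have "{k. 1 \<le> k \<and> S k \<le> t} = {1..n}" unfolding * by auto
  then show ?thesis by simp
qed

locale ml_renewal = prob_space M for M :: "'a measure" +
  fixes lam \<alpha> :: real and X :: "nat \<Rightarrow> 'a \<Rightarrow> real"
  assumes lam_pos: "0 < lam" and \<alpha>_pos: "0 < \<alpha>" and \<alpha>_le_1: "\<alpha> \<le> 1"
    and indep: "indep_vars (\<lambda>_. borel) X UNIV"
    and X_distributed: "\<And>n. distributed M lborel (X n) (\<lambda>x. ennreal (interarrival_density lam \<alpha> x))"
begin

definition epoch :: "nat \<Rightarrow> 'a \<Rightarrow> real" where "epoch n \<omega> = (\<Sum>i<n. X i \<omega>)"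

definition count :: "real \<Rightarrow> 'a \<Rightarrow> nat" where "count t \<omega> = card {n. 1 \<le> n \<and> epoch n \<omega> \<le> t}"

text \<open>
  The sample points at which the epochs increase strictly to infinity. They have full measure
  (\<open>AE_regular\<close>), and on them \<open>count t\<close> is the index of the last epoch up to time \<open>t\<close>. Elsewhere infinitely
  many epochs may lie below \<open>t\<close>, and then \<open>count t\<close> is 0 since the cardinality of an infinite set is 0.
\<close>

definition regular :: "'a \<Rightarrow> bool" where
  "regular \<omega> \<longleftrightarrow> (\<forall>i. 0 < X i \<omega>) \<and> (\<forall>t. \<exists>n. t < epoch n \<omega>)"

lemma X_measurable [measurable]: "X n \<in> borel_measurable M"
  using indep by (simp add: indep_vars_def)

lemma epoch_measurable [measurable]: "epoch n \<in> borel_measurable M"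
  unfolding epoch_def[abs_def] by measurable

lemma density_measurable [measurable]: "interarrival_density lam \<alpha> \<in> borel_measurable borel"
  by (rule interarrival_density_measurable[OF \<alpha>_pos])

lemma density_nonneg: "0 \<le> interarrival_density lam \<alpha> x"
  by (rule interarrival_density_nonneg[OF lam_pos \<alpha>_pos \<alpha>_le_1])

lemma AE_X_pos: "AE \<omega> in M. \<forall>i. 0 < X i \<omega>"
proof -
  have "AE \<omega> in M. 0 < X i \<omega>" for i
    using distributed_AE2[OF X_distributed[of i], of "\<lambda>x. 0 < x"]
    by (auto simp: interarrival_density_def)
  then show ?thesis by (simp add: AE_all_countable)
qed

lemma epoch_nonneg: "\<forall>i. 0 < X i \<omega> \<Longrightarrow> 0 \<le> epoch n \<omega>"
  by (simp add: epoch_def sum_nonneg less_imp_le)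

lemma epoch_strict_mono: "\<forall>i. 0 < X i \<omega> \<Longrightarrow> strict_mono (\<lambda>n. epoch n \<omega>)"
  by (simp add: strict_mono_Suc_iff epoch_def)

lemma indep_epoch: "indep_var borel (epoch n) borel (X n)"
proof -
  have "indep_var borel ((\<lambda>f. \<Sum>i<n. f i) \<circ> (\<lambda>\<omega>. restrict (\<lambda>i. X i \<omega>) {..<n}))
      borel ((\<lambda>f. f n) \<circ> (\<lambda>\<omega>. restrict (\<lambda>i. X i \<omega>) {n}))"
    by (intro indep_var_compose[OF indep_var_restrict[OF indep]]) auto
  also have "(\<lambda>f. \<Sum>i<n. f i) \<circ> (\<lambda>\<omega>. restrict (\<lambda>i. X i \<omega>) {..<n}) = epoch n"
    by (simp add: fun_eq_iff epoch_def)
  also have "(\<lambda>f. f n) \<circ> (\<lambda>\<omega>. restrict (\<lambda>i. X i \<omega>) {n}) = X n" by auto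
  finally show ?thesis .
qed

text \<open>
  Chernoff bound: \<open>P(S\<^sub>n \<le> t) \<le> e\<^sup>t E(exp (-S\<^sub>n)) = e\<^sup>t \<rho>\<^sup>n\<close>, where \<open>\<rho> = E(exp (-X\<^sub>0)) < 1\<close> because interarrival times
  are positive.
\<close>

lemma prob_epoch_le_tendsto_0: "(\<lambda>n. prob {\<omega> \<in> space M. epoch n \<omega> \<le> t}) \<longlonglongrightarrow> 0"
proof -
  define \<rho> where "\<rho> = (\<integral>x. interarrival_density lam \<alpha> x * exp (- x) \<partial>lborel)"
  have E: "expectation (\<lambda>\<omega>. exp (- X i \<omega>)) = \<rho>" for i
    unfolding \<rho>_def using distributed_integral[OF X_distributed[of i], of "\<lambda>x. exp (- x)"] density_nonneg by simp
  have int: "integrable M (\<lambda>\<omega>. exp (- X i \<omega>))" for i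
    using AE_X_pos by (intro integrable_const_bound[of _ 1]) (auto elim!: eventually_mono simp: less_imp_le)
  have \<rho>1: "\<rho> < 1"
    unfolding E[of 0, symmetric] using AE_X_pos by (intro expectation_less int) (auto elim!: eventually_mono)
  have \<rho>0: "0 \<le> \<rho>" unfolding E[of 0, symmetric] by simp
  have ind: "indep_vars (\<lambda>_. borel) (\<lambda>i \<omega>. exp (- X i \<omega>)) {..<n}" for n
    by (rule indep_vars_compose2[OF indep_vars_subset[OF indep]]) auto
  have exp_epoch: "exp (- epoch n \<omega>) = (\<Prod>i<n. exp (- X i \<omega>))" for n \<omega>
    by (simp add: epoch_def exp_sum flip: sum_negf)
  have int_epoch: "integrable M (\<lambda>\<omega>. exp (- epoch n \<omega>) :: real)" for n
    using AE_X_pos by (intro integrable_const_bound[of _ 1]) (auto elim!: eventually_mono simp: epoch_nonneg)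
  have bound: "prob {\<omega> \<in> space M. epoch n \<omega> \<le> t} \<le> exp t * \<rho> ^ n" for n
  proof -
    have "prob {\<omega> \<in> space M. epoch n \<omega> \<le> t} = expectation (indicator {\<omega> \<in> space M. epoch n \<omega> \<le> t})"
      by simp
    also have "\<dots> \<le> expectation (\<lambda>\<omega>. exp t * exp (- epoch n \<omega>))"
    proof (rule integral_mono)
      show "integrable M (indicator {\<omega> \<in> space M. epoch n \<omega> \<le> t} :: 'a \<Rightarrow> real)"
        by (intro integrable_real_indicator) (simp_all add: less_top[symmetric])
      show "integrable M (\<lambda>\<omega>. exp t * exp (- epoch n \<omega>))"
        using int_epoch by (rule integrable_mult_right)
      show "indicator {\<omega> \<in> space M. epoch n \<omega> \<le> t} \<omega> \<le> exp t * exp (- epoch n \<omega>)" for \<omega>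
        by (simp add: indicator_def flip: exp_add)
    qed
    also have "\<dots> = exp t * \<rho> ^ n"
      using indep_vars_lebesgue_integral[OF _ ind int, of n] by (simp add: exp_epoch E)
    finally show ?thesis .
  qed
  have "(\<lambda>n. exp t * \<rho> ^ n) \<longlonglongrightarrow> exp t * 0"
    using \<rho>0 \<rho>1 by (intro tendsto_mult tendsto_const LIMSEQ_realpow_zero)
  then have lim: "(\<lambda>n. exp t * \<rho> ^ n) \<longlonglongrightarrow> 0" by simp
  show ?thesis
  proof (rule real_tendsto_sandwich[OF _ _ tendsto_const lim])
    show "\<forall>\<^sub>F n in sequentially. 0 \<le> prob {\<omega> \<in> space M. epoch n \<omega> \<le> t}" by simp
    show "\<forall>\<^sub>F n in sequentially. prob {\<omega> \<in> space M. epoch n \<omega> \<le> t} \<le> exp t * \<rho> ^ n"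
      by (intro always_eventually allI bound)
  qed
qed

lemma AE_regular: "AE \<omega> in M. regular \<omega>"
proof -
  have "AE \<omega> in M. \<exists>n. real k < epoch n \<omega>" for k :: nat
  proof -
    let ?A = "{\<omega> \<in> space M. \<forall>n. epoch n \<omega> \<le> real k}"
    have "prob ?A \<le> prob {\<omega> \<in> space M. epoch n \<omega> \<le> real k}" for n
      by (intro finite_measure_mono) auto
    then have "prob ?A \<le> 0"
      using LIMSEQ_le_const[OF prob_epoch_le_tendsto_0] by blast
    then have "prob ?A = 0" by (simp add: antisym)
    then have "AE \<omega> in M. \<omega> \<notin> ?A" by (subst (asm) prob_eq_0) auto
    then show ?thesis using AE_space by eventually_elim (auto simp: not_le)
  qed
  then have "AE \<omega> in M. \<forall>k::nat. \<exists>n. real k < epoch n \<omega>" by (simp add: AE_all_countable)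
  with AE_X_pos show ?thesis
  proof eventually_elim
    case (elim \<omega>)
    have "\<exists>n. t < epoch n \<omega>" for t
    proof -
      obtain k :: nat where "t < real k" using reals_Archimedean2 by blast
      then show ?thesis using elim(2) by (meson less_trans)
    qed
    then show ?case using elim by (simp add: regular_def)
  qed
qed

lemma regular_bracket:
  assumes "regular \<omega>" "0 \<le> t"
  shows "epoch (count t \<omega>) \<omega> \<le> t" "t < epoch (Suc (count t \<omega>)) \<omega>"
proof -
  have sm: "strict_mono (\<lambda>n. epoch n \<omega>)" using assms by (simp add: regular_def epoch_strict_mono)
  obtain k where k: "t < epoch k \<omega>" "\<And>j. j < k \<Longrightarrow> epoch j \<omega> \<le> t"
    using assms(1) exists_least_iff[of "\<lambda>n. t < epoch n \<omega>"] by (auto simp: regular_def not_less)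
  then obtain n where n: "k = Suc n"
    using assms(2) by (cases k) (auto simp: epoch_def)
  then have "count t \<omega> = n"
    unfolding count_def using k by (intro card_epochs_le[OF sm]) auto
  then show "epoch (count t \<omega>) \<omega> \<le> t" "t < epoch (Suc (count t \<omega>)) \<omega>" using k n by auto
qed

lemma epoch_le_iff:
  assumes "regular \<omega>" "0 \<le> t"
  shows "epoch k \<omega> \<le> t \<longleftrightarrow> k \<le> count t \<omega>"
proof -
  have sm: "strict_mono (\<lambda>n. epoch n \<omega>)" using assms by (simp add: regular_def epoch_strict_mono)
  show ?thesis
  proof
    assume "epoch k \<omega> \<le> t"
    then have "epoch k \<omega> < epoch (Suc (count t \<omega>)) \<omega>" using regular_bracket(2)[OF assms] by linarith
    then show "k \<le> count t \<omega>" using strict_mono_less[OF sm] by (simp add: less_Suc_eq_le)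
  next
    assume "k \<le> count t \<omega>"
    then have "epoch k \<omega> \<le> epoch (count t \<omega>) \<omega>" using strict_mono_less_eq[OF sm] by simp
    then show "epoch k \<omega> \<le> t" using regular_bracket(1)[OF assms] by linarith
  qed
qed

lemma count_eqI:
  assumes "regular \<omega>" "epoch n \<omega> \<le> t" "t < epoch (Suc n) \<omega>"
  shows "count t \<omega> = n"
  unfolding count_def using assms by (intro card_epochs_le epoch_strict_mono) (auto simp: regular_def)

lemma count_compose_measurable:
  assumes [measurable]: "T \<in> borel_measurable M"
  shows "(\<lambda>\<omega>. count (T \<omega>) \<omega>) \<in> measurable M (count_space UNIV)"
  unfolding count_def by measurable

text \<open>
  The renewal equation evaluated at the remaining time \<open>x - S\<^sub>n\<close>: conditioning on \<open>S\<^sub>n\<close>, the next interarrival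
  time contributes one convolution with its density.
\<close>

lemma pgf_step:
  assumes s: "s \<noteq> 0" and x: "0 \<le> x"
  defines "h \<equiv> renewal_pgf lam \<alpha> s"
  shows "expectation (\<lambda>\<omega>. if epoch (Suc n) \<omega> \<le> x then s\<^sup>2 * h (x - epoch (Suc n) \<omega>) - 1 else 0)
       = expectation (\<lambda>\<omega>. if epoch n \<omega> \<le> x then h (x - epoch n \<omega>) - 1 else 0)"
proof -
  \<comment> \<open>Truncation at \<open>x\<close> makes the integrand bounded and changes nothing, as epochs are nonnegative.\<close>
  define G where "G y = (if 0 \<le> y \<and> y \<le> x then s\<^sup>2 * h y - 1 else 0)" for y
  have [measurable]: "h \<in> borel_measurable borel" unfolding h_def by (rule renewal_pgf_measurable[OF \<alpha>_pos])
  have [measurable]: "G \<in> borel_measurable borel" unfolding G_def[abs_def] by measurable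
  obtain B where B: "0 < B" "\<And>y. y \<in> {0..x} \<Longrightarrow> norm (h y) \<le> B"
    using renewal_pgf_bounded[OF \<alpha>_pos] unfolding h_def by blast
  have GB: "norm (G y) \<le> norm (s\<^sup>2) * B + 1" for y
  proof (cases "0 \<le> y \<and> y \<le> x")
    case True
    have "norm (s\<^sup>2 * h y - 1) \<le> norm (s\<^sup>2 * h y) + norm (1::complex)" by (rule norm_triangle_ineq4)
    also have "norm (s\<^sup>2 * h y) \<le> norm (s\<^sup>2) * B"
      unfolding norm_mult[of "s\<^sup>2"] using True B by (intro mult_left_mono) auto
    finally show ?thesis using True by (simp add: G_def)
  next
    case False
    have "0 \<le> norm (s\<^sup>2) * B" using B by simp
    then show ?thesis using False by (auto simp: G_def)
  qed
  have "expectation (\<lambda>\<omega>. if epoch (Suc n) \<omega> \<le> x then s\<^sup>2 * h (x - epoch (Suc n) \<omega>) - 1 else 0)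
      = expectation (\<lambda>\<omega>. G (x - (epoch n \<omega> + X n \<omega>)))"
  proof (rule integral_cong_AE)
    show "AE \<omega> in M. (if epoch (Suc n) \<omega> \<le> x then s\<^sup>2 * h (x - epoch (Suc n) \<omega>) - 1 else 0) = G (x - (epoch n \<omega> + X n \<omega>))"
      using AE_X_pos
    proof eventually_elim
      case (elim \<omega>)
      have "epoch n \<omega> + X n \<omega> = epoch (Suc n) \<omega>" by (simp add: epoch_def)
      then show ?case using epoch_nonneg[OF elim, of "Suc n"] by (auto simp: G_def)
    qed
  qed measurable
  also have "\<dots> = expectation (\<lambda>\<omega>. \<integral>y. interarrival_density lam \<alpha> y *\<^sub>R G (x - epoch n \<omega> - y) \<partial>lborel)"
    by (rule expectation_indep_density_sum[OF indep_epoch X_distributed _ density_nonneg _ GB]) measurable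
  also have "\<dots> = expectation (\<lambda>\<omega>. if epoch n \<omega> \<le> x then h (x - epoch n \<omega>) - 1 else 0)"
  proof (rule integral_cong_AE)
    show "AE \<omega> in M. (\<integral>y. interarrival_density lam \<alpha> y *\<^sub>R G (x - epoch n \<omega> - y) \<partial>lborel)
        = (if epoch n \<omega> \<le> x then h (x - epoch n \<omega>) - 1 else 0)"
      using AE_X_pos
    proof eventually_elim
      case (elim \<omega>)
      have "interarrival_density lam \<alpha> y *\<^sub>R G (x - epoch n \<omega> - y)
          = interarrival_density lam \<alpha> y *\<^sub>R
            (if 0 \<le> (x - epoch n \<omega>) - y then s\<^sup>2 * h ((x - epoch n \<omega>) - y) - 1 else 0)" for y
        using epoch_nonneg[OF elim, of n] by (auto simp: G_def interarrival_density_def)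
      then have "(\<integral>y. interarrival_density lam \<alpha> y *\<^sub>R G (x - epoch n \<omega> - y) \<partial>lborel)
          = (if 0 \<le> x - epoch n \<omega> then h (x - epoch n \<omega>) - 1 else 0)"
        using has_bochner_integral_integral_eq[OF renewal_pgf_equation[OF \<alpha>_pos s, of lam "x - epoch n \<omega>"]]
        unfolding h_def by (simp only:)
      then show ?case by simp
    qed
  qed measurable
  finally show ?thesis .
qed

text \<open>
  Iterating \<open>pgf_step\<close>. With \<open>a\<^sub>n = E(h(x - S\<^sub>n); S\<^sub>n \<le> x)\<close> and \<open>b\<^sub>n = P(S\<^sub>n \<le> x)\<close> that step reads
  \<open>a\<^sub>n - b\<^sub>n = u a\<^sub>n\<^sub>+\<^sub>1 - b\<^sub>n\<^sub>+\<^sub>1\<close>, which telescopes from \<open>a\<^sub>0 = h x\<close>. The second claim makes the remainder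
  \<open>u\<^sup>n a\<^sub>n\<close> vanish in the limit.
\<close>

lemma pgf_partial_sum:
  assumes s: "s \<noteq> 0" and x: "0 \<le> x"
  defines "h \<equiv> renewal_pgf lam \<alpha> s"
  shows "(\<Sum>k<n. (s\<^sup>2) ^ k * of_real (prob {\<omega> \<in> space M. epoch k \<omega> \<le> x} - prob {\<omega> \<in> space M. epoch (Suc k) \<omega> \<le> x}))
       + (s\<^sup>2) ^ n * expectation (\<lambda>\<omega>. if epoch n \<omega> \<le> x then h (x - epoch n \<omega>) else 0) = h x"
    (is "?sum n + _ * ?a n = _")
    and "\<exists>B. \<forall>n. norm (expectation (\<lambda>\<omega>. if epoch n \<omega> \<le> x then h (x - epoch n \<omega>) else 0))
            \<le> B * prob {\<omega> \<in> space M. epoch n \<omega> \<le> x}"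
proof -
  let ?p = "\<lambda>n. prob {\<omega> \<in> space M. epoch n \<omega> \<le> x}"
  have [measurable]: "h \<in> borel_measurable borel" unfolding h_def by (rule renewal_pgf_measurable[OF \<alpha>_pos])
  obtain B where B: "0 < B" "\<And>y. y \<in> {0..x} \<Longrightarrow> norm (h y) \<le> B"
    using renewal_pgf_bounded[OF \<alpha>_pos] unfolding h_def by blast
  have bnd: "AE \<omega> in M. norm (if epoch n \<omega> \<le> x then h (x - epoch n \<omega>) else 0) \<le> B * indicator {\<omega> \<in> space M. epoch n \<omega> \<le> x} \<omega>" for n
    using AE_X_pos AE_space
  proof eventually_elim
    case (elim \<omega>)
    then show ?case using B(2)[of "x - epoch n \<omega>"] epoch_nonneg[of \<omega> n] by auto
  qed
  have int: "integrable M (\<lambda>\<omega>. if epoch n \<omega> \<le> x then h (x - epoch n \<omega>) else 0)" for n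
    using bnd[of n] B(1)
    by (intro integrable_const_bound[of _ B]) (auto elim!: eventually_mono simp: indicator_def split: if_splits)
  have ind: "integrable M (\<lambda>\<omega>. of_real (indicator {\<omega> \<in> space M. epoch n \<omega> \<le> x} \<omega>) :: complex)"
    and Eind: "expectation (\<lambda>\<omega>. of_real (indicator {\<omega> \<in> space M. epoch n \<omega> \<le> x} \<omega>) :: complex) = of_real (?p n)" for n
    by (auto intro!: integrable_of_real integrable_real_indicator simp: less_top[symmetric])
  have step: "?a n - of_real (?p n) = s\<^sup>2 * ?a (Suc n) - of_real (?p (Suc n))" for n
  proof -
    have "expectation (\<lambda>\<omega>. if epoch (Suc n) \<omega> \<le> x then s\<^sup>2 * h (x - epoch (Suc n) \<omega>) - 1 else 0)
        = expectation (\<lambda>\<omega>. s\<^sup>2 * (if epoch (Suc n) \<omega> \<le> x then h (x - epoch (Suc n) \<omega>) else 0)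
            - of_real (indicator {\<omega> \<in> space M. epoch (Suc n) \<omega> \<le> x} \<omega>))"
      by (intro Bochner_Integration.integral_cong) auto
    also have "\<dots> = s\<^sup>2 * ?a (Suc n) - of_real (?p (Suc n))"
      using int[of "Suc n"] ind[of "Suc n"] Eind[of "Suc n"] by simp
    finally have 1: "expectation (\<lambda>\<omega>. if epoch (Suc n) \<omega> \<le> x then s\<^sup>2 * h (x - epoch (Suc n) \<omega>) - 1 else 0)
        = s\<^sup>2 * ?a (Suc n) - of_real (?p (Suc n))" .
    have "expectation (\<lambda>\<omega>. if epoch n \<omega> \<le> x then h (x - epoch n \<omega>) - 1 else 0)
        = expectation (\<lambda>\<omega>. (if epoch n \<omega> \<le> x then h (x - epoch n \<omega>) else 0)
            - of_real (indicator {\<omega> \<in> space M. epoch n \<omega> \<le> x} \<omega>))"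
      by (intro Bochner_Integration.integral_cong) auto
    also have "\<dots> = ?a n - of_real (?p n)"
      using int[of n] ind[of n] Eind[of n] by simp
    finally have 2: "expectation (\<lambda>\<omega>. if epoch n \<omega> \<le> x then h (x - epoch n \<omega>) - 1 else 0) = ?a n - of_real (?p n)" .
    show ?thesis
      by (rule trans[OF trans[OF 2[symmetric] pgf_step[OF s x, of n, folded h_def, symmetric]] 1])
  qed
  show "?sum n + (s\<^sup>2) ^ n * ?a n = h x"
  proof (induction n)
    case 0
    then show ?case using x by (simp add: epoch_def prob_space)
  next
    case (Suc n)
    have "?sum (Suc n) + (s\<^sup>2) ^ Suc n * ?a (Suc n)
        = ?sum n + (s\<^sup>2) ^ n * (of_real (?p n) - of_real (?p (Suc n)) + s\<^sup>2 * ?a (Suc n))"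
      by (simp add: algebra_simps)
    also have "of_real (?p n) - of_real (?p (Suc n)) + s\<^sup>2 * ?a (Suc n) = ?a n"
      using step[of n] by (simp add: algebra_simps)
    finally show ?case unfolding Suc .
  qed
  have "norm (?a n) \<le> B * ?p n" for n
  proof -
    have "norm (?a n) \<le> expectation (\<lambda>\<omega>. B * indicator {\<omega> \<in> space M. epoch n \<omega> \<le> x} \<omega>)"
    proof (rule order.trans[OF integral_norm_bound integral_mono_AE[OF _ _ bnd]])
      show "integrable M (\<lambda>\<omega>. norm (if epoch n \<omega> \<le> x then h (x - epoch n \<omega>) else 0))"
        by (rule integrable_norm[OF int])
      show "integrable M (\<lambda>\<omega>. B * indicator {\<omega> \<in> space M. epoch n \<omega> \<le> x} \<omega>)"
        by (intro integrable_mult_right integrable_real_indicator) (simp_all add: less_top[symmetric])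
    qed
    then show ?thesis by simp
  qed
  then show "\<exists>B. \<forall>n. norm (?a n) \<le> B * ?p n" by blast
qed

text \<open>
  The partial sums of \<open>\<Sum> u\<^sup>k P(S\<^sub>k \<le> x < S\<^sub>k\<^sub>+\<^sub>1)\<close> converge both to the generating function and, by
  \<open>pgf_partial_sum\<close>, to the closed form.
\<close>

lemma pgf_count:
  assumes s: "s \<noteq> 0" and x: "0 \<le> x" and u: "norm (s\<^sup>2) \<le> 1"
  shows "expectation (\<lambda>\<omega>. (s\<^sup>2) ^ count x \<omega>) = renewal_pgf lam \<alpha> s x"
proof -
  let ?I = "\<lambda>k \<omega>. of_real (indicator {\<omega> \<in> space M. epoch k \<omega> \<le> x} \<omega>) :: complex"
  let ?p = "\<lambda>n. prob {\<omega> \<in> space M. epoch n \<omega> \<le> x}"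
  let ?a = "\<lambda>n. expectation (\<lambda>\<omega>. if epoch n \<omega> \<le> x then renewal_pgf lam \<alpha> s (x - epoch n \<omega>) else 0)"
  \<comment> \<open>At a regular point all summands vanish except the one with \<open>k = count x \<omega>\<close>.\<close>
  define F where "F n \<omega> = (\<Sum>k<n. (s\<^sup>2) ^ k * (?I k \<omega> - ?I (Suc k) \<omega>))" for n \<omega>
  have [measurable]: "(\<lambda>\<omega>. count x \<omega>) \<in> measurable M (count_space UNIV)"
    by (rule count_compose_measurable) simp
  have F: "F n \<omega> = (if count x \<omega> < n then (s\<^sup>2) ^ count x \<omega> else 0)" if "regular \<omega>" "\<omega> \<in> space M" for n \<omega>
  proof -
    have "?I k \<omega> - ?I (Suc k) \<omega> = (if k = count x \<omega> then 1 else 0)" for k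
      using that(2) by (simp add: indicator_def epoch_le_iff[OF that(1) x])
    then have "F n \<omega> = (\<Sum>k<n. if k = count x \<omega> then (s\<^sup>2) ^ k else 0)"
      unfolding F_def by (intro sum.cong) auto
    then show ?thesis by (simp add: sum.delta)
  qed
  have "(\<lambda>n. expectation (F n)) \<longlonglongrightarrow> expectation (\<lambda>\<omega>. (s\<^sup>2) ^ count x \<omega>)"
  proof (rule integral_dominated_convergence[where w = "\<lambda>_. 1"])
    show "AE \<omega> in M. (\<lambda>n. F n \<omega>) \<longlonglongrightarrow> (s\<^sup>2) ^ count x \<omega>"
      using AE_regular AE_space
    proof eventually_elim
      case (elim \<omega>)
      have "\<forall>\<^sub>F n in sequentially. F n \<omega> = (s\<^sup>2) ^ count x \<omega>"
        using eventually_gt_at_top[of "count x \<omega>"] by eventually_elim (simp add: F elim)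
      then show ?case by (rule tendsto_eventually)
    qed
    show "AE \<omega> in M. norm (F n \<omega>) \<le> 1" for n
      using AE_regular AE_space
      by eventually_elim (use u in \<open>auto simp: F norm_power power_le_one\<close>)
  qed (auto simp: F_def[abs_def])
  moreover have "expectation (F n) = renewal_pgf lam \<alpha> s x - (s\<^sup>2) ^ n * ?a n" for n
  proof -
    have "expectation (F n) = (\<Sum>k<n. (s\<^sup>2) ^ k * of_real (?p k - ?p (Suc k)))"
      unfolding F_def
      by (subst Bochner_Integration.integral_sum)
         (auto intro!: integrable_real_indicator simp: less_top[symmetric])
    then show ?thesis using pgf_partial_sum(1)[OF s x, of n] by (simp add: algebra_simps)
  qed
  moreover have "(\<lambda>n. renewal_pgf lam \<alpha> s x - (s\<^sup>2) ^ n * ?a n) \<longlonglongrightarrow> renewal_pgf lam \<alpha> s x - 0"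
  proof (intro tendsto_diff tendsto_const)
    obtain B where B: "\<And>n. norm (?a n) \<le> B * ?p n" using pgf_partial_sum(2)[OF s x] by blast
    have "(\<lambda>n. B * ?p n) \<longlonglongrightarrow> B * 0" by (intro tendsto_mult tendsto_const prob_epoch_le_tendsto_0)
    then have lim: "(\<lambda>n. B * ?p n) \<longlonglongrightarrow> 0" by simp
    have "norm ((s\<^sup>2) ^ n * ?a n) \<le> B * ?p n" for n
    proof -
      have "norm ((s\<^sup>2) ^ n) \<le> 1"
        unfolding norm_power[of "s\<^sup>2"] by (rule power_le_one[OF norm_ge_zero u])
      from mult_right_mono[OF this norm_ge_zero[of "?a n"]]
      have "norm ((s\<^sup>2) ^ n * ?a n) \<le> norm (?a n)" unfolding norm_mult by simp
      then show ?thesis using B[of n] by linarith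
    qed
    then show "(\<lambda>n. (s\<^sup>2) ^ n * ?a n) \<longlonglongrightarrow> 0"
      by (intro Lim_null_comparison[OF _ lim] always_eventually allI)
  qed
  ultimately show ?thesis by (simp add: LIMSEQ_unique)
qed

end



section \<open>Substitution of an independent random time\<close>

text \<open>
  Substitution of a countably valued random index \<open>J\<close> into a family \<open>Y\<close>. It suffices to know the expectation
  of \<open>Y j\<close> on each event \<open>J = j\<close>; independence is one way to get it.
\<close>

lemma (in prob_space) expectation_random_index:
  fixes Y :: "nat \<Rightarrow> 'a \<Rightarrow> complex" and c :: "nat \<Rightarrow> complex"
  assumes [measurable]: "\<And>j. Y j \<in> borel_measurable M" and J[measurable]: "J \<in> measurable M (count_space UNIV)"
    and Y: "\<And>j \<omega>. norm (Y j \<omega>) \<le> 1" and c: "\<And>j. norm (c j) \<le> 1"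
    and eq: "\<And>j. expectation (\<lambda>\<omega>. indicator {j} (J \<omega>) * Y j \<omega>) = expectation (\<lambda>\<omega>. indicator {j} (J \<omega>)) * c j"
  shows "expectation (\<lambda>\<omega>. Y (J \<omega>) \<omega>) = expectation (\<lambda>\<omega>. c (J \<omega>))"
proof -
  have [measurable]: "(\<lambda>\<omega>. indicator {j} (J \<omega>) :: complex) \<in> borel_measurable M" for j
    by (rule measurable_compose[OF J]) simp
  have lim: "(\<lambda>m. \<Sum>j<m. expectation (\<lambda>\<omega>. indicator {j} (J \<omega>) * Z j \<omega>)) \<longlonglongrightarrow> expectation (\<lambda>\<omega>. Z (J \<omega>) \<omega>)"
    if Zm: "\<And>j. Z j \<in> borel_measurable M" and Z: "\<And>j \<omega>. norm (Z j \<omega>) \<le> 1" for Z :: "nat \<Rightarrow> 'a \<Rightarrow> complex"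
  proof -
    note [measurable] = Zm
    define F where "F m \<omega> = (\<Sum>j<m. indicator {j} (J \<omega>) * Z j \<omega>)" for m \<omega>
    have F: "F m \<omega> = (if J \<omega> < m then Z (J \<omega>) \<omega> else 0)" for m \<omega>
    proof -
      have "F m \<omega> = (\<Sum>j<m. if J \<omega> = j then Z j \<omega> else 0)"
        unfolding F_def by (intro sum.cong) (auto simp: indicator_def)
      then show ?thesis by simp
    qed
    have "(\<lambda>m. expectation (F m)) \<longlonglongrightarrow> expectation (\<lambda>\<omega>. Z (J \<omega>) \<omega>)"
    proof (rule integral_dominated_convergence[where w = "\<lambda>_. 1"])
      show "(\<lambda>\<omega>. Z (J \<omega>) \<omega>) \<in> borel_measurable M"
        by (rule measurable_compose_countable'[where I = UNIV]) simp_all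
      show "F m \<in> borel_measurable M" for m unfolding F_def[abs_def] by measurable
      show "AE \<omega> in M. (\<lambda>m. F m \<omega>) \<longlonglongrightarrow> Z (J \<omega>) \<omega>"
      proof (rule AE_I2)
        fix \<omega>
        have "\<forall>\<^sub>F m in sequentially. F m \<omega> = Z (J \<omega>) \<omega>"
          using eventually_gt_at_top[of "J \<omega>"] by eventually_elim (simp add: F)
        then show "(\<lambda>m. F m \<omega>) \<longlonglongrightarrow> Z (J \<omega>) \<omega>" by (rule tendsto_eventually)
      qed
      show "AE \<omega> in M. norm (F m \<omega>) \<le> 1" for m by (rule AE_I2) (simp add: F Z)
    qed simp
    moreover have "expectation (F m) = (\<Sum>j<m. expectation (\<lambda>\<omega>. indicator {j} (J \<omega>) * Z j \<omega>))" for m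
      unfolding F_def
    proof (rule Bochner_Integration.integral_sum)
      fix j
      show "integrable M (\<lambda>\<omega>. indicator {j} (J \<omega>) * Z j \<omega>)"
        by (rule integrable_const_bound[of _ 1]) (auto simp: indicator_def Z)
    qed
    ultimately show ?thesis by simp
  qed
  have "expectation (\<lambda>\<omega>. indicator {j} (J \<omega>) * Y j \<omega>) = expectation (\<lambda>\<omega>. indicator {j} (J \<omega>) * c j)" for j
    unfolding eq by simp
  then show ?thesis
    using lim[of Y] lim[of "\<lambda>j _. c j"] LIMSEQ_unique by (simp add: Y c)
qed

context ml_renewal
begin

text \<open>
  A bound that is not visible in the series: it holds because the function is a generating function. It
  is the majorant in every later limit.
\<close>

lemma renewal_pgf_norm_le_1:
  assumes "s \<noteq> 0" "0 \<le> x" "norm (s\<^sup>2) \<le> 1"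
  shows "norm (renewal_pgf lam \<alpha> s x) \<le> 1"
proof -
  have "norm (expectation (\<lambda>\<omega>. (s\<^sup>2) ^ count x \<omega>)) \<le> expectation (\<lambda>\<omega>. norm ((s\<^sup>2) ^ count x \<omega>))"
    by (rule integral_norm_bound)
  also have "\<dots> \<le> 1"
  proof (rule integral_le_const)
    have *: "norm ((s\<^sup>2) ^ count x \<omega>) \<le> 1" for \<omega>
      unfolding norm_power[of "s\<^sup>2"] by (rule power_le_one[OF norm_ge_zero assms(3)])
    have [measurable]: "(\<lambda>\<omega>. count x \<omega>) \<in> measurable M (count_space UNIV)"
      by (rule count_compose_measurable) simp
    show "integrable M (\<lambda>\<omega>. norm ((s\<^sup>2) ^ count x \<omega>))"
      by (rule integrable_norm, rule integrable_const_bound[OF AE_I2[OF *]]) measurable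
    show "AE \<omega> in M. norm ((s\<^sup>2) ^ count x \<omega>) \<le> 1" by (rule AE_I2) (rule *)
  qed
  finally show ?thesis by (simp only: pgf_count[OF assms])
qed

text \<open>
  Independence is assumed for the count at each single fixed time only. The random time is therefore
  rounded up to the grid \<open>{j / (k + 1)}\<close>, whose countably many values are within the reach of
  \<open>expectation_random_index\<close>. Rounding up, rather than down, matches the right-continuity of the counting
  process.
\<close>

lemma pgf_time_change:
  assumes s: "s \<noteq> 0" and u: "norm (s\<^sup>2) \<le> 1"
    and T[measurable]: "T \<in> borel_measurable M" and T0: "AE \<omega> in M. 0 \<le> T \<omega>"
    and ind: "\<And>q. 0 \<le> q \<Longrightarrow> indep_var borel (\<lambda>\<omega>. real (count q \<omega>)) borel T"
  shows "expectation (\<lambda>\<omega>. (s\<^sup>2) ^ count (T \<omega>) \<omega>) = expectation (\<lambda>\<omega>. renewal_pgf lam \<alpha> s (T \<omega>))"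
proof -
  let ?h = "renewal_pgf lam \<alpha> s"
  define J where "J k \<omega> = nat \<lceil>real (Suc k) * T \<omega>\<rceil>" for k \<omega>
  define G where "G k \<omega> = real (J k \<omega>) / real (Suc k)" for k \<omega>
  have [measurable]: "?h \<in> borel_measurable borel" by (rule renewal_pgf_measurable[OF \<alpha>_pos])
  have [measurable]: "J k \<in> measurable M (count_space UNIV)" for k unfolding J_def[abs_def] by measurable
  have [measurable]: "G k \<in> borel_measurable M" for k unfolding G_def[abs_def] by measurable
  have cnt[measurable]: "(\<lambda>\<omega>. count (R \<omega>) \<omega>) \<in> measurable M (count_space UNIV)"
    if "R \<in> borel_measurable M" for R
    using that by (rule count_compose_measurable)
  have meas: "(\<lambda>\<omega>. (s\<^sup>2) ^ count (R \<omega>) \<omega>) \<in> borel_measurable M" if "R \<in> borel_measurable M" for R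
    by (rule measurable_compose[OF cnt[OF that]]) simp
  have pow1: "norm ((s\<^sup>2) ^ n) \<le> 1" for n
    unfolding norm_power[of "s\<^sup>2"] by (rule power_le_one[OF norm_ge_zero u])
  have GT: "T \<omega> \<le> G k \<omega>" "G k \<omega> \<le> T \<omega> + 1 / real (Suc k)" if "0 \<le> T \<omega>" for k \<omega>
  proof -
    have "0 \<le> real (Suc k) * T \<omega>" using that by simp
    then have "real (J k \<omega>) = of_int \<lceil>real (Suc k) * T \<omega>\<rceil>" unfolding J_def by simp
    then have lo: "real (Suc k) * T \<omega> \<le> real (J k \<omega>)" and hi: "real (J k \<omega>) \<le> real (Suc k) * T \<omega> + 1"
      by linarith+
    have "T \<omega> \<le> G k \<omega>"
      unfolding G_def using lo by (simp add: pos_le_divide_eq mult.commute del: of_nat_Suc)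
    moreover have "G k \<omega> \<le> (real (Suc k) * T \<omega> + 1) / real (Suc k)"
      unfolding G_def by (rule divide_right_mono[OF hi]) simp
    moreover have "(real (Suc k) * T \<omega> + 1) / real (Suc k) = T \<omega> + 1 / real (Suc k)"
      unfolding add_divide_distrib by simp
    ultimately show "T \<omega> \<le> G k \<omega>" "G k \<omega> \<le> T \<omega> + 1 / real (Suc k)" by simp_all
  qed
  have Glim: "(\<lambda>k. G k \<omega>) \<longlonglongrightarrow> T \<omega>" if "0 \<le> T \<omega>" for \<omega>
  proof (rule real_tendsto_sandwich)
    show "\<forall>\<^sub>F k in sequentially. T \<omega> \<le> G k \<omega>" "\<forall>\<^sub>F k in sequentially. G k \<omega> \<le> T \<omega> + 1 / real (Suc k)"
      using GT[OF that] by auto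
    show "(\<lambda>k. T \<omega> + 1 / real (Suc k)) \<longlonglongrightarrow> T \<omega>"
      using tendsto_add[OF tendsto_const LIMSEQ_inverse_real_of_nat] by (simp add: inverse_eq_divide)
  qed simp
  have grid: "expectation (\<lambda>\<omega>. (s\<^sup>2) ^ count (G k \<omega>) \<omega>) = expectation (\<lambda>\<omega>. ?h (G k \<omega>))" for k
  proof -
    let ?q = "\<lambda>j. real j / real (Suc k)"
    have "expectation (\<lambda>\<omega>. (s\<^sup>2) ^ count (?q (J k \<omega>)) \<omega>) = expectation (\<lambda>\<omega>. ?h (?q (J k \<omega>)))"
    proof (rule expectation_random_index[where Y = "\<lambda>j \<omega>. (s\<^sup>2) ^ count (?q j) \<omega>"])
      fix j
      let ?f = "\<lambda>r::real. (s\<^sup>2) ^ nat \<lfloor>r\<rfloor>" and ?g = "\<lambda>t::real. indicator {j} (nat \<lceil>real (Suc k) * t\<rceil>) :: complex"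
      have "indep_var borel (?f \<circ> (\<lambda>\<omega>. real (count (?q j) \<omega>))) borel (?g \<circ> T)"
        by (rule indep_var_compose[OF ind]) (simp, measurable)
      then have I: "indep_var borel (\<lambda>\<omega>. (s\<^sup>2) ^ count (?q j) \<omega>) borel (\<lambda>\<omega>. indicator {j} (J k \<omega>) :: complex)"
        by (simp add: comp_def J_def)
      have "expectation (\<lambda>\<omega>. (s\<^sup>2) ^ count (?q j) \<omega> * indicator {j} (J k \<omega>))
          = expectation (\<lambda>\<omega>. (s\<^sup>2) ^ count (?q j) \<omega>) * expectation (\<lambda>\<omega>. indicator {j} (J k \<omega>))"
      proof (rule indep_var_lebesgue_integral[OF I])
        show "integrable M (\<lambda>\<omega>. (s\<^sup>2) ^ count (?q j) \<omega>)"
          by (rule integrable_const_bound[of _ 1]) (rule AE_I2, rule pow1, measurable)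
        show "integrable M (\<lambda>\<omega>. indicator {j} (J k \<omega>) :: complex)"
          by (rule integrable_const_bound[of _ 1]) (simp_all add: indicator_def)
      qed
      then show "expectation (\<lambda>\<omega>. indicator {j} (J k \<omega>) * (s\<^sup>2) ^ count (?q j) \<omega>)
          = expectation (\<lambda>\<omega>. indicator {j} (J k \<omega>)) * ?h (?q j)"
        using pgf_count[OF s _ u, of "?q j"] by (simp add: mult.commute)
      show "norm (?h (?q j)) \<le> 1" by (rule renewal_pgf_norm_le_1[OF s _ u]) simp
      show "norm ((s\<^sup>2) ^ count (?q j) \<omega>) \<le> 1" for \<omega> by (rule pow1)
      show "(\<lambda>\<omega>. (s\<^sup>2) ^ count (?q j) \<omega>) \<in> borel_measurable M" by measurable
    qed measurable
    then show ?thesis by (simp only: G_def)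
  qed
  have "(\<lambda>k. expectation (\<lambda>\<omega>. (s\<^sup>2) ^ count (G k \<omega>) \<omega>)) \<longlonglongrightarrow> expectation (\<lambda>\<omega>. (s\<^sup>2) ^ count (T \<omega>) \<omega>)"
  proof (rule integral_dominated_convergence[where w = "\<lambda>_. 1"])
    show "AE \<omega> in M. (\<lambda>k. (s\<^sup>2) ^ count (G k \<omega>) \<omega>) \<longlonglongrightarrow> (s\<^sup>2) ^ count (T \<omega>) \<omega>"
      using AE_regular T0
    proof eventually_elim
      case (elim \<omega>)
      note br = regular_bracket[OF elim]
      have "\<forall>\<^sub>F k in sequentially. G k \<omega> < epoch (Suc (count (T \<omega>) \<omega>)) \<omega>"
        by (rule order_tendstoD(2)[OF Glim[OF elim(2)] br(2)])
      then have "\<forall>\<^sub>F k in sequentially. (s\<^sup>2) ^ count (G k \<omega>) \<omega> = (s\<^sup>2) ^ count (T \<omega>) \<omega>"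
      proof eventually_elim
        case (elim k)
        have "epoch (count (T \<omega>) \<omega>) \<omega> \<le> G k \<omega>"
          using br(1) GT(1)[OF \<open>0 \<le> T \<omega>\<close>, of k] by linarith
        then show ?case using count_eqI[OF \<open>regular \<omega>\<close> _ elim] by simp
      qed
      then show ?case by (rule tendsto_eventually)
    qed
    show "AE \<omega> in M. norm ((s\<^sup>2) ^ count (G k \<omega>) \<omega>) \<le> 1" for k by (rule AE_I2) (rule pow1)
  qed (simp_all add: meas)
  moreover have "(\<lambda>k. expectation (\<lambda>\<omega>. ?h (G k \<omega>))) \<longlonglongrightarrow> expectation (\<lambda>\<omega>. ?h (T \<omega>))"
  proof (rule integral_dominated_convergence[where w = "\<lambda>_. 1"])
    show "AE \<omega> in M. (\<lambda>k. ?h (G k \<omega>)) \<longlonglongrightarrow> ?h (T \<omega>)"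
      using T0
    proof eventually_elim
      case (elim \<omega>)
      have "0 \<le> G k \<omega>" for k by (simp add: G_def)
      then show ?case
        using continuous_on_tendsto_compose[OF renewal_pgf_cont[OF \<alpha>_pos] Glim[OF elim]] elim by simp
    qed
    show "AE \<omega> in M. norm (?h (G k \<omega>)) \<le> 1" for k
      by (rule AE_I2, rule renewal_pgf_norm_le_1[OF s _ u]) (simp add: G_def)
  qed simp_all
  ultimately show ?thesis unfolding grid by (rule LIMSEQ_unique)
qed

end



section \<open>Expansion into moments\<close>

text \<open>
  Abel's limit theorem. With \<open>S\<close> the sum and \<open>e\<^sub>n\<close> the deviation of the \<open>n\<close>-th partial sum from \<open>S\<close>,
  multiplication by the geometric series gives
  \<open>\<Sum> a\<^sub>n r\<^sup>n - S = (1 - r) \<Sum> e\<^sub>n r\<^sup>n\<close>; finitely many \<open>e\<^sub>n\<close> are killed by the factor \<open>1 - r\<close>, and the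
  rest is at most \<open>\<epsilon> / 2\<close>.
\<close>

lemma abel_limit:
  fixes a :: "nat \<Rightarrow> complex"
  assumes a: "summable a"
  shows "((\<lambda>r::real. \<Sum>n. a n * of_real r ^ n) \<longlongrightarrow> suminf a) (at_left 1)"
proof -
  define S where "S = suminf a"
  define e where "e n = (\<Sum>i\<le>n. a i) - S" for n
  have e0: "e \<longlonglongrightarrow> 0"
    using tendsto_diff[OF summable_LIMSEQ'[OF a] tendsto_const, of S] by (simp add: e_def[abs_def] S_def)
  have ident: "summable (\<lambda>n. norm (e n * of_real r ^ n))"
      "(\<Sum>n. a n * of_real r ^ n) - S = of_real (1 - r) * (\<Sum>n. e n * of_real r ^ n)"
    if r: "0 < r" "r < 1" for r :: real
  proof -
    have geo: "summable (\<lambda>n. norm (complex_of_real r ^ n))"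
      using r by (simp add: norm_power summable_geometric)
    have ar: "summable (\<lambda>n. norm (a n * of_real r ^ n))"
      by (rule powser_insidea[of a 1]) (use a r in simp_all)
    have eq: "(\<Sum>i\<le>n. (a i * of_real r ^ i) * of_real r ^ (n - i)) = (\<Sum>i\<le>n. a i) * complex_of_real r ^ n" for n
      unfolding sum_distrib_right by (intro sum.cong refl) (simp add: mult.assoc flip: power_add)
    have prod: "(\<Sum>n. a n * of_real r ^ n) * (\<Sum>n. of_real r ^ n) = (\<Sum>n. (\<Sum>i\<le>n. a i) * complex_of_real r ^ n)"
      and sumprod: "summable (\<lambda>n. (\<Sum>i\<le>n. a i) * complex_of_real r ^ n)"
      using Cauchy_product[OF ar geo] summable_Cauchy_product[OF ar geo] unfolding eq by simp_all
    have gsum: "(\<Sum>n. of_real r ^ n) = 1 / (1 - complex_of_real r)"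
      by (rule suminf_geometric) (use r in simp)
    have r1: "1 - complex_of_real r \<noteq> 0" using r by (metis eq_iff_diff_eq_0 less_irrefl of_real_1 of_real_eq_iff)
    obtain B where B: "\<And>n. norm (e n) \<le> B"
      using convergent_imp_Bseq[of e] e0 unfolding Bseq_def convergent_def by blast
    show "summable (\<lambda>n. norm (e n * of_real r ^ n))"
    proof (rule summable_comparison_test')
      show "summable (\<lambda>n. B * r ^ n)" using r by (intro summable_mult summable_geometric) simp
      show "norm (norm (e n * of_real r ^ n)) \<le> B * r ^ n" for n
        using B[of n] r by (simp add: norm_mult norm_power mult_right_mono)
    qed
    have "(\<Sum>n. e n * of_real r ^ n) = (\<Sum>n. (\<Sum>i\<le>n. a i) * complex_of_real r ^ n) - (\<Sum>n. S * of_real r ^ n)"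
      unfolding suminf_diff[OF sumprod summable_mult[OF summable_norm_cancel[OF geo]]]
      by (simp add: e_def left_diff_distrib)
    also have "(\<Sum>n. S * of_real r ^ n) = S / (1 - of_real r)"
      using suminf_mult[OF summable_norm_cancel[OF geo], of S] by (simp add: gsum)
    finally show "(\<Sum>n. a n * of_real r ^ n) - S = of_real (1 - r) * (\<Sum>n. e n * of_real r ^ n)"
      using r1 by (simp add: prod[symmetric] gsum field_simps)
  qed
  show ?thesis
    unfolding S_def[symmetric] tendsto_iff
  proof (intro allI impI)
    fix \<epsilon> :: real assume \<epsilon>: "0 < \<epsilon>"
    obtain N where N: "\<And>n. N \<le> n \<Longrightarrow> norm (e n) \<le> \<epsilon> / 2"
      using order_tendstoD(2)[OF tendsto_norm_zero[OF e0], of "\<epsilon> / 2"] \<epsilon>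
      by (auto simp: eventually_sequentially intro: less_imp_le)
    define C where "C = (\<Sum>n<N. norm (e n))"
    have bound: "norm ((\<Sum>n. a n * of_real r ^ n) - S) \<le> (1 - r) * C + \<epsilon> / 2" if r: "0 < r" "r < 1" for r :: real
    proof -
      have geo: "summable (\<lambda>n. \<epsilon> / 2 * r ^ n)" using r by (intro summable_mult summable_geometric) simp
      have fin: "summable (\<lambda>n. if n < N then norm (e n) else 0)"
        by (rule summable_finite[of "{..<N}"]) auto
      have "norm (\<Sum>n. e n * of_real r ^ n) \<le> (\<Sum>n. norm (e n * of_real r ^ n))"
        by (rule summable_norm[OF ident(1)[OF r]])
      also have "\<dots> \<le> (\<Sum>n. (if n < N then norm (e n) else 0) + \<epsilon> / 2 * r ^ n)"
      proof (rule suminf_le[OF _ ident(1)[OF r] summable_add[OF fin geo]])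
        fix n
        show "norm (e n * of_real r ^ n) \<le> (if n < N then norm (e n) else 0) + \<epsilon> / 2 * r ^ n"
        proof (cases "n < N")
          case True
          have "norm (e n) * r ^ n \<le> norm (e n)"
            using r by (intro mult_left_le power_le_one) auto
          moreover have "0 \<le> \<epsilon> / 2 * r ^ n" using \<epsilon> r by simp
          ultimately have "norm (e n) * r ^ n \<le> norm (e n) + \<epsilon> / 2 * r ^ n" by linarith
          then show ?thesis using True r by (simp add: norm_mult norm_power)
        next
          case False
          then have "norm (e n) * r ^ n \<le> \<epsilon> / 2 * r ^ n"
            using N[of n] r by (intro mult_right_mono) auto
          then show ?thesis using False r by (simp add: norm_mult norm_power)
        qed
      qed
      also have "\<dots> = C + \<epsilon> / 2 * (1 / (1 - r))"
      proof -
        have "(\<Sum>n. if n < N then norm (e n) else 0) = C"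
          unfolding C_def by (subst suminf_finite[of "{..<N}"]) auto
        moreover have "(\<Sum>n. \<epsilon> / 2 * r ^ n) = \<epsilon> / 2 * (1 / (1 - r))"
          using r by (subst suminf_mult) (simp_all add: summable_geometric suminf_geometric)
        ultimately show ?thesis using suminf_add[OF fin geo] by simp
      qed
      finally have "(1 - r) * norm (\<Sum>n. e n * of_real r ^ n) \<le> (1 - r) * (C + \<epsilon> / 2 * (1 / (1 - r)))"
        using r by (intro mult_left_mono) auto
      also have "\<dots> = (1 - r) * C + \<epsilon> / 2" using r by (simp add: field_simps)
      finally show ?thesis
        unfolding ident(2)[OF r] norm_mult norm_of_real using r by simp
    qed
    have "((\<lambda>r. (1 - r) * C + \<epsilon> / 2) \<longlongrightarrow> (1 - 1) * C + \<epsilon> / 2) (at_left 1)"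
      by (intro tendsto_intros)
    then have "\<forall>\<^sub>F r in at_left 1. (1 - r) * C + \<epsilon> / 2 < \<epsilon>"
      by (rule order_tendstoD(2)) (use \<epsilon> in simp)
    moreover have "\<forall>\<^sub>F r in at_left (1::real). r \<in> {0<..<1}"
      by (rule eventually_at_left_real) simp
    ultimately show "\<forall>\<^sub>F r in at_left 1. dist (\<Sum>n. a n * of_real r ^ n) S < \<epsilon>"
    proof eventually_elim
      case (elim r)
      then show ?case using bound[of r] by (simp add: dist_norm)
    qed
  qed
qed

text \<open>
  Moments of a nonnegative variable are nonnegative, so absolute convergence of the moment series is
  summability of the expected absolute values of the terms, as Fubini's theorem requires.
\<close>

lemma (in prob_space) expectation_mittag_leffler:
  assumes \<alpha>: "0 < \<alpha>" and [measurable]: "T \<in> borel_measurable M" and T0: "AE \<omega> in M. 0 \<le> T \<omega>"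
    and mom: "\<And>r. 0 < r \<Longrightarrow> integrable M (\<lambda>\<omega>. T \<omega> powr r)"
    and sum: "summable (\<lambda>l. norm (moment_series_term M \<alpha> T z l))"
  shows "integrable M (\<lambda>\<omega>. mittag_leffler \<alpha> (z * of_real (T \<omega> powr \<alpha>)))"
    and "expectation (\<lambda>\<omega>. mittag_leffler \<alpha> (z * of_real (T \<omega> powr \<alpha>))) = suminf (moment_series_term M \<alpha> T z)"
proof -
  define f where "f l \<omega> = z ^ l / complex_of_real (Gamma (\<alpha> * real l + 1)) * of_real ((T \<omega> powr \<alpha>) ^ l)" for l \<omega>
  have powr_eq: "AE \<omega> in M. (if \<alpha> * real l = 0 then 1 else T \<omega> powr (\<alpha> * real l)) = (T \<omega> powr \<alpha>) ^ l" for l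
    using T0
  proof eventually_elim
    case (elim \<omega>)
    show ?case
    proof (cases "T \<omega> = 0")
      case True
      then show ?thesis using \<alpha> by (cases l) auto
    next
      case False
      then show ?thesis using elim \<alpha> by (simp add: powr_powr[symmetric] powr_realpow)
    qed
  qed
  have int_pow: "integrable M (\<lambda>\<omega>. (T \<omega> powr \<alpha>) ^ l)" for l
  proof -
    have "integrable M (\<lambda>\<omega>. if \<alpha> * real l = 0 then 1 else T \<omega> powr (\<alpha> * real l))"
      using \<alpha> mom[of "\<alpha> * real l"] by (cases "l = 0") simp_all
    then show ?thesis
      by (rule integrable_cong_AE_imp) (use powr_eq[of l] in \<open>auto elim!: eventually_mono\<close>)
  qed
  have E_pow: "expectation (\<lambda>\<omega>. (T \<omega> powr \<alpha>) ^ l) = moment M T (\<alpha> * real l)" for l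
  proof -
    have "AE \<omega> in M. (T \<omega> powr \<alpha>) ^ l = (if \<alpha> * real l = 0 then 1 else T \<omega> powr (\<alpha> * real l))"
      using powr_eq[of l] by eventually_elim (simp only:)
    from integral_cong_AE[OF _ _ this] show ?thesis unfolding moment_def by simp
  qed
  have 1: "integrable M (f l)" for l
    unfolding f_def by (intro integrable_mult_right integrable_of_real int_pow)
  have fml: "(\<Sum>l. f l \<omega>) = mittag_leffler \<alpha> (z * of_real (T \<omega> powr \<alpha>))" for \<omega>
    by (simp add: f_def mittag_leffler_def power_mult_distrib)
  have 2: "AE \<omega> in M. summable (\<lambda>l. norm (f l \<omega>))"
  proof (rule AE_I2)
    fix \<omega>
    show "summable (\<lambda>l. norm (f l \<omega>))"
      using mittag_leffler_summable[OF \<alpha>, of "z * of_real (T \<omega> powr \<alpha>)"]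
      by (simp add: f_def power_mult_distrib)
  qed
  have Ef: "expectation (f l) = moment_series_term M \<alpha> T z l" for l
    unfolding f_def moment_series_term_def E_pow[symmetric]
    by (simp only: integral_mult_right_zero integral_complex_of_real)
  have "expectation (\<lambda>\<omega>. norm (f l \<omega>)) = norm (moment_series_term M \<alpha> T z l)" for l
  proof -
    have "expectation (\<lambda>\<omega>. norm (f l \<omega>))
        = expectation (\<lambda>\<omega>. norm (z ^ l / complex_of_real (Gamma (\<alpha> * real l + 1))) * (T \<omega> powr \<alpha>) ^ l)"
    proof -
      have "norm (complex_of_real ((T \<omega> powr \<alpha>) ^ l)) = (T \<omega> powr \<alpha>) ^ l" for \<omega>
        by (simp add: norm_power)
      then show ?thesis unfolding f_def norm_mult by (simp only:)
    qed
    also have "\<dots> = norm (z ^ l / complex_of_real (Gamma (\<alpha> * real l + 1))) * moment M T (\<alpha> * real l)"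
      by (simp only: integral_mult_right_zero E_pow)
    also have "moment M T (\<alpha> * real l) = norm (complex_of_real (moment M T (\<alpha> * real l)))"
      unfolding E_pow[symmetric] by simp
    finally show ?thesis unfolding moment_series_term_def norm_mult .
  qed
  then have 3: "summable (\<lambda>l. expectation (\<lambda>\<omega>. norm (f l \<omega>)))" using sum by simp
  show "integrable M (\<lambda>\<omega>. mittag_leffler \<alpha> (z * of_real (T \<omega> powr \<alpha>)))"
    using integrable_suminf[OF 1 2 3] by (simp only: fml)
  show "expectation (\<lambda>\<omega>. mittag_leffler \<alpha> (z * of_real (T \<omega> powr \<alpha>))) = suminf (moment_series_term M \<alpha> T z)"
    using integral_suminf[OF 1 2 3] by (simp only: fml Ef)
qed

lemma moment_series_term_scale:
  "moment_series_term M \<alpha> T (of_real r * z) l = moment_series_term M \<alpha> T z l * of_real r ^ l"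
  by (simp add: moment_series_term_def power_mult_distrib)

lemma moment_series_scaled_summable:
  assumes "summable (moment_series_term M \<alpha> T z)" "0 < r" "r < 1"
  shows "summable (\<lambda>l. norm (moment_series_term M \<alpha> T (of_real r * z) l))"
  unfolding moment_series_term_scale
  by (rule powser_insidea[of _ 1]) (use assms in simp_all)

text \<open>
  Time and rate enter only through \<open>\<lambda> x\<^sup>\<alpha>\<close>, so damping both series arguments by \<open>r\<close> is a change of time scale.
\<close>

lemma renewal_pgf_rescale:
  assumes "0 < \<alpha>" "0 < r" "0 \<le> x"
  shows "renewal_pgf lam \<alpha> s (r powr (1 / \<alpha>) * x)
    = (s + 1) / (2 * s) * mittag_leffler \<alpha> (of_real r * - (of_real lam * (1 - s)) * of_real (x powr \<alpha>)) +
      (s - 1) / (2 * s) * mittag_leffler \<alpha> (of_real r * - (of_real lam * (1 + s)) * of_real (x powr \<alpha>))"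
proof -
  have "(r powr (1 / \<alpha>) * x) powr \<alpha> = r * x powr \<alpha>"
    using assms by (simp add: powr_mult powr_powr)
  then have "z * complex_of_real ((r powr (1 / \<alpha>) * x) powr \<alpha>) = of_real r * z * of_real (x powr \<alpha>)" for z
    by simp
  then show ?thesis unfolding renewal_pgf_def by (simp only:)
qed

text \<open>
  Both sides are limits as \<open>r \<rightarrow> 1\<close> of the damped identity, in which all series converge absolutely: the left
  one by dominated convergence with majorant 1, the right one by \<open>abel_limit\<close>. The bound on \<open>u = s\<^sup>2\<close> is what
  provides the majorant.
\<close>

lemma (in ml_renewal) expectation_renewal_pgf_eq_pgf_formula:
  assumes s: "s \<noteq> 0" and u: "norm (s\<^sup>2) \<le> 1"
    and T[measurable]: "T \<in> borel_measurable M" and T0: "AE \<omega> in M. 0 \<le> T \<omega>"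
    and mom: "\<And>r. 0 < r \<Longrightarrow> integrable M (\<lambda>\<omega>. T \<omega> powr r)"
    and conv: "both_series_converge M lam \<alpha> T s"
  shows "expectation (\<lambda>\<omega>. renewal_pgf lam \<alpha> s (T \<omega>)) = pgf_formula M lam \<alpha> T s"
proof -
  let ?h = "renewal_pgf lam \<alpha> s"
  define A B where "A = (s + 1) / (2 * s)" and "B = (s - 1) / (2 * s)"
  define z w where "z = - (complex_of_real lam * (1 - s))" and "w = - (complex_of_real lam * (1 + s))"
  \<comment> \<open>The shift by two keeps the damping factors strictly between 0 and 1.\<close>
  define \<rho> where "\<rho> n = 1 - inverse (real (Suc (Suc n)))" for n
  have \<rho>: "0 < \<rho> n" "\<rho> n < 1" for n
    by (simp_all add: \<rho>_def inverse_less_1_iff)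
  have \<rho>_lim: "\<rho> \<longlonglongrightarrow> 1"
    using tendsto_diff[OF tendsto_const LIMSEQ_Suc[OF LIMSEQ_inverse_real_of_nat], of 1] by (simp add: \<rho>_def[abs_def])
  have \<rho>_left: "filterlim \<rho> (at_left 1) sequentially"
    unfolding filterlim_at using \<rho>_lim \<rho>(2) by (auto simp: less_imp_neq)
  have [measurable]: "?h \<in> borel_measurable borel" by (rule renewal_pgf_measurable[OF \<alpha>_pos])
  have sz: "summable (moment_series_term M \<alpha> T z)" and sw: "summable (moment_series_term M \<alpha> T w)"
    using conv by (simp_all add: both_series_converge_def z_def w_def)
  have abel: "(\<lambda>n. suminf (moment_series_term M \<alpha> T (of_real (\<rho> n) * v))) \<longlonglongrightarrow> suminf (moment_series_term M \<alpha> T v)"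
    if "summable (moment_series_term M \<alpha> T v)" for v
  proof -
    have "suminf (moment_series_term M \<alpha> T (of_real r * v)) = (\<Sum>l. moment_series_term M \<alpha> T v l * of_real r ^ l)" for r
      by (intro arg_cong[where f = suminf] ext moment_series_term_scale)
    then show ?thesis using filterlim_compose[OF abel_limit[OF that] \<rho>_left] by (simp only:)
  qed
  have scaled: "expectation (\<lambda>\<omega>. ?h (\<rho> n powr (1 / \<alpha>) * T \<omega>))
      = A * suminf (moment_series_term M \<alpha> T (of_real (\<rho> n) * z)) + B * suminf (moment_series_term M \<alpha> T (of_real (\<rho> n) * w))" for n
  proof -
    note Ez = expectation_mittag_leffler[OF \<alpha>_pos T T0 mom moment_series_scaled_summable[OF sz \<rho>[of n]]]
    note Ew = expectation_mittag_leffler[OF \<alpha>_pos T T0 mom moment_series_scaled_summable[OF sw \<rho>[of n]]]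
    have "expectation (\<lambda>\<omega>. ?h (\<rho> n powr (1 / \<alpha>) * T \<omega>))
        = expectation (\<lambda>\<omega>. A * mittag_leffler \<alpha> (of_real (\<rho> n) * z * of_real (T \<omega> powr \<alpha>))
            + B * mittag_leffler \<alpha> (of_real (\<rho> n) * w * of_real (T \<omega> powr \<alpha>)))"
    proof (rule integral_cong_AE)
      show "AE \<omega> in M. ?h (\<rho> n powr (1 / \<alpha>) * T \<omega>)
          = A * mittag_leffler \<alpha> (of_real (\<rho> n) * z * of_real (T \<omega> powr \<alpha>))
            + B * mittag_leffler \<alpha> (of_real (\<rho> n) * w * of_real (T \<omega> powr \<alpha>))"
        using T0 unfolding A_def B_def z_def w_def
        by eventually_elim (rule renewal_pgf_rescale[OF \<alpha>_pos \<rho>(1)])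
      show "(\<lambda>\<omega>. A * mittag_leffler \<alpha> (of_real (\<rho> n) * z * of_real (T \<omega> powr \<alpha>))
            + B * mittag_leffler \<alpha> (of_real (\<rho> n) * w * of_real (T \<omega> powr \<alpha>))) \<in> borel_measurable M"
        by (intro borel_measurable_add borel_measurable_times borel_measurable_const borel_measurable_integrable Ez Ew)
    qed simp
    also have "\<dots> = A * suminf (moment_series_term M \<alpha> T (of_real (\<rho> n) * z)) + B * suminf (moment_series_term M \<alpha> T (of_real (\<rho> n) * w))"
      using Ez Ew by simp
    finally show ?thesis .
  qed
  have "(\<lambda>n. expectation (\<lambda>\<omega>. ?h (\<rho> n powr (1 / \<alpha>) * T \<omega>))) \<longlonglongrightarrow> expectation (\<lambda>\<omega>. ?h (T \<omega>))"
  proof (rule integral_dominated_convergence[where w = "\<lambda>_. 1"])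
    show "AE \<omega> in M. (\<lambda>n. ?h (\<rho> n powr (1 / \<alpha>) * T \<omega>)) \<longlonglongrightarrow> ?h (T \<omega>)"
      using T0
    proof eventually_elim
      case (elim \<omega>)
      have "(\<lambda>n. \<rho> n powr (1 / \<alpha>) * T \<omega>) \<longlonglongrightarrow> 1 powr (1 / \<alpha>) * T \<omega>"
        by (intro tendsto_mult tendsto_powr \<rho>_lim tendsto_const) simp
      then have lim: "(\<lambda>n. \<rho> n powr (1 / \<alpha>) * T \<omega>) \<longlonglongrightarrow> T \<omega>" by simp
      show ?case
        using continuous_on_tendsto_compose[OF renewal_pgf_cont[OF \<alpha>_pos] lim] elim by simp
    qed
    show "AE \<omega> in M. norm (?h (\<rho> n powr (1 / \<alpha>) * T \<omega>)) \<le> 1" for n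
      using T0 by eventually_elim (rule renewal_pgf_norm_le_1[OF s _ u], simp)
  qed simp_all
  moreover have "(\<lambda>n. expectation (\<lambda>\<omega>. ?h (\<rho> n powr (1 / \<alpha>) * T \<omega>)))
      \<longlonglongrightarrow> A * suminf (moment_series_term M \<alpha> T z) + B * suminf (moment_series_term M \<alpha> T w)"
    unfolding scaled by (intro tendsto_add tendsto_mult tendsto_const abel sz sw)
  ultimately have "expectation (\<lambda>\<omega>. ?h (T \<omega>)) = A * suminf (moment_series_term M \<alpha> T z) + B * suminf (moment_series_term M \<alpha> T w)"
    by (rule LIMSEQ_unique)
  then show ?thesis by (simp add: pgf_formula_def A_def B_def z_def w_def)
qed

section \<open>The generating function of the time-changed process\<close>

lemma (in prob_space) prob_gen_fun_tendsto_0: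
  assumes Y: "Y \<in> measurable M (count_space UNIV)"
  shows "(prob_gen_fun M Y \<longlongrightarrow> prob_gen_fun M Y 0) (at 0)"
proof -
  have meas: "(\<lambda>\<omega>. u ^ Y \<omega>) \<in> borel_measurable M" for u :: complex
    by (rule measurable_compose[OF Y]) simp
  have "((\<lambda>u. prob_gen_fun M Y u) \<longlongrightarrow> prob_gen_fun M Y 0) (at 0 within ball 0 1)"
    unfolding tendsto_at_iff_sequentially comp_def
  proof (intro allI impI)
    fix v :: "nat \<Rightarrow> complex"
    assume v: "\<forall>i. v i \<in> ball 0 1 - {0}" "v \<longlonglongrightarrow> 0"
    show "(\<lambda>i. prob_gen_fun M Y (v i)) \<longlonglongrightarrow> prob_gen_fun M Y 0"
      unfolding prob_gen_fun_def
    proof (rule integral_dominated_convergence[where w = "\<lambda>_. 1"])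
      show "AE \<omega> in M. (\<lambda>i. v i ^ Y \<omega>) \<longlonglongrightarrow> 0 ^ Y \<omega>"
        by (intro AE_I2 tendsto_power v)
      show "AE \<omega> in M. norm (v i ^ Y \<omega>) \<le> 1" for i
        unfolding norm_power using v(1) by (intro AE_I2 power_le_one) (auto simp: less_imp_le)
    qed (simp_all add: meas)
  qed
  moreover have "at (0::complex) within ball 0 1 = at 0" by (rule at_within_open) simp_all
  ultimately show ?thesis by (simp only:)
qed

lemma levy_subordinator_nonneg:
  assumes "levy_subordinator M f D" "0 \<le> t"
  shows "AE \<omega> in M. 0 \<le> D t \<omega>"
proof -
  have "AE \<omega> in M. mono_on {0..} (\<lambda>t. D t \<omega>)" "AE \<omega> in M. D 0 \<omega> = 0"
    using assms by (auto simp: levy_subordinator_def levy_process_def)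
  then show ?thesis
  proof eventually_elim
    case (elim \<omega>)
    then show ?case using mono_onD[OF elim(1), of 0 t] assms(2) by simp
  qed
qed

theorem theorem5p2:
  fixes M :: "'a measure"
    and lam \<alpha> :: real
    and N :: "real \<Rightarrow> 'a \<Rightarrow> nat"
    and D :: "real \<Rightarrow> 'a \<Rightarrow> real"
    and f :: "real \<Rightarrow> real"
    and sqroot :: "complex \<Rightarrow> complex"
    and t :: real
  assumes "prob_space M"
    and "0 < lam" and "0 < \<alpha>" and "\<alpha> \<le> 1"
    and "renewal_counting_process M (interarrival_density lam \<alpha>) N"
    and "levy_subordinator M f D"
    and "independent_processes M N D"
    and "\<forall>r>0. \<forall>v\<ge>0. integrable M (\<lambda>\<omega>. D v \<omega> powr r)"
    and "\<forall>u. (sqroot u)\<^sup>2 = u"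
    and "0 \<le> t"
  shows "(\<forall>u. u \<noteq> 0 \<and> norm u \<le> 1 \<and> both_series_converge M lam \<alpha> (D t) (sqroot u) \<longrightarrow>
            prob_gen_fun M (time_changed N D t) u = pgf_formula M lam \<alpha> (D t) (sqroot u)) \<and>
         ((\<forall>\<^sub>F u in at 0. both_series_converge M lam \<alpha> (D t) (sqroot u)) \<longrightarrow>
            ((\<lambda>u. pgf_formula M lam \<alpha> (D t) (sqroot u))
               \<longlongrightarrow> prob_gen_fun M (time_changed N D t) 0) (at 0))"
proof -
  interpret prob_space M by fact
  obtain X :: "nat \<Rightarrow> 'a \<Rightarrow> real" where X: "indep_vars (\<lambda>_. borel) X UNIV"
      "\<And>n. distributed M lborel (X n) (\<lambda>x. ennreal (interarrival_density lam \<alpha> x))"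
    and N: "\<And>q \<omega>. \<omega> \<in> space M \<Longrightarrow> N q \<omega> = card {n. 1 \<le> n \<and> (\<Sum>i<n. X i \<omega>) \<le> q}"
    using \<open>renewal_counting_process M (interarrival_density lam \<alpha>) N\<close>
    unfolding renewal_counting_process_def by blast
  interpret ml_renewal M lam \<alpha> X
    by unfold_locales (use assms X in auto)
  have N_count: "N q \<omega> = count q \<omega>" if "\<omega> \<in> space M" for q \<omega>
    using N[OF that] by (simp add: count_def epoch_def)
  have D[measurable]: "D t \<in> borel_measurable M"
    using \<open>levy_subordinator M f D\<close> \<open>0 \<le> t\<close> by (auto simp: levy_subordinator_def levy_process_def)
  have D0: "AE \<omega> in M. 0 \<le> D t \<omega>"
    using levy_subordinator_nonneg[OF \<open>levy_subordinator M f D\<close> \<open>0 \<le> t\<close>] .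
  have mom: "integrable M (\<lambda>\<omega>. D t \<omega> powr r)" if "0 < r" for r
    using assms(8) that \<open>0 \<le> t\<close> by blast
  have ind: "indep_var borel (\<lambda>\<omega>. real (count q \<omega>)) borel (D t)" if "0 \<le> q" for q
  proof -
    have "indep_var borel ((\<lambda>p. p q) \<circ> (\<lambda>\<omega>. \<lambda>t\<in>{0..}. real (N t \<omega>)))
        borel ((\<lambda>p. p t) \<circ> (\<lambda>\<omega>. \<lambda>t\<in>{0..}. D t \<omega>))"
      by (rule indep_var_compose[OF \<open>independent_processes M N D\<close>[unfolded independent_processes_def]])
         (use that \<open>0 \<le> t\<close> in \<open>auto intro!: measurable_component_singleton\<close>)
    then have I: "indep_var borel (\<lambda>\<omega>. real (N q \<omega>)) borel (D t)"
      using that \<open>0 \<le> t\<close> by (simp add: comp_def)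
    have [measurable]: "(\<lambda>\<omega>. count q \<omega>) \<in> measurable M (count_space UNIV)"
      by (rule count_compose_measurable) simp
    have "distr M borel (\<lambda>\<omega>. real (N q \<omega>)) = distr M borel (\<lambda>\<omega>. real (count q \<omega>))"
      "distr M (borel \<Otimes>\<^sub>M borel) (\<lambda>\<omega>. (real (N q \<omega>), D t \<omega>)) = distr M (borel \<Otimes>\<^sub>M borel) (\<lambda>\<omega>. (real (count q \<omega>), D t \<omega>))"
      by (simp_all add: N_count cong: distr_cong)
    then show ?thesis
      using I unfolding indep_var_distribution_eq by simp
  qed
  have gf: "prob_gen_fun M (time_changed N D t) u = expectation (\<lambda>\<omega>. u ^ count (D t \<omega>) \<omega>)" for u
    unfolding prob_gen_fun_def time_changed_def
    by (rule Bochner_Integration.integral_cong) (simp_all add: N_count)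
  have formula: "prob_gen_fun M (time_changed N D t) u = pgf_formula M lam \<alpha> (D t) (sqroot u)"
    if u: "u \<noteq> 0" "norm u \<le> 1" "both_series_converge M lam \<alpha> (D t) (sqroot u)" for u
  proof -
    have sq: "(sqroot u)\<^sup>2 = u" using assms(9) by blast
    then have s: "sqroot u \<noteq> 0" and n: "norm ((sqroot u)\<^sup>2) \<le> 1" using u by auto
    show ?thesis
      using pgf_time_change[OF s n D D0 ind] expectation_renewal_pgf_eq_pgf_formula[OF s n D D0 mom u(3)]
      by (simp only: gf sq)
  qed
  have "((\<lambda>u. pgf_formula M lam \<alpha> (D t) (sqroot u)) \<longlongrightarrow> prob_gen_fun M (time_changed N D t) 0) (at 0)"
    if conv: "\<forall>\<^sub>F u in at 0. both_series_converge M lam \<alpha> (D t) (sqroot u)"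
  proof -
    have "(\<lambda>\<omega>. count (D t \<omega>) \<omega>) \<in> measurable M (count_space UNIV)"
      by (rule count_compose_measurable) simp
    from prob_gen_fun_tendsto_0[OF this]
    have lim: "(prob_gen_fun M (time_changed N D t) \<longlongrightarrow> prob_gen_fun M (time_changed N D t) 0) (at 0)"
      unfolding gf[abs_def] by (simp add: prob_gen_fun_def[abs_def])
    have "\<forall>\<^sub>F u in at (0::complex). u \<in> ball 0 1 - {0}"
      unfolding eventually_at by (intro exI[of _ 1]) (auto simp: dist_norm)
    with conv have "\<forall>\<^sub>F u in at 0. prob_gen_fun M (time_changed N D t) u = pgf_formula M lam \<alpha> (D t) (sqroot u)"
      by eventually_elim (rule formula, auto)
    from Lim_transform_eventually[OF lim this] show ?thesis .
  qed
  with formula show ?thesis by blast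
qed

end
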